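(* For every match $(k,i,j)\in\mathcal M$, the inequality $x_{k,i,j}\ge 0$ is facet-defining for $P_{\mathrm{utt}}(n)$.
   Context: Let $n\ge4$ be even, $V=\{1,\dots,n\}$ (teams; team $i$ has home venue $i$), $S=\{1,\dots,2n-2\}$ (slots), $A=\{(i,j)\in V\times V:i\ne j\}$, $\mathcal M=\{(k,i,j):k\in S,(i,j)\in A\}$, where $(k,i,j)$ denotes the match between $i$ and $j$ at venue $i$ in slot $k$. A tournament is a set $T\subseteq\mathcal M$ whose incidence vector $x=\chi(T)\in\{0,1\}^{\mathcal M}$ satisfies $\sum_{j\in V\setminus\{i\}}(x_{k,i,j}+x_{k,j,i})=1$ for all $k\in S$, $k\ge2$, $i\in V$, and $\sum_{k\in S}x_{k,i,j}=1$ for all $(i,j)\in A$. In $T$, team $t$ is at venue $t$ in a slot where it plays at home and at venue $i$ in slot $k$ if $(k,i,t)\in T$; before slot 1 and after slot $2n-2$ it is at venue $t$. Team $t$ travels from venue $i$ to venue $j\ne i$ if it is at $i$ and then at $j$ at consecutive positions of (start, slot $1$, …, slot $2n-2$, end). The travel vector $\psi(T)\in\{0,1\}^{V\times A}$ has $\psi(T)_{t,i,j}=1$ iff team $t$ travels from $i$ to $j$. $P_{\mathrm{utt}}(n)=\mathrm{conv}\{(\chi(T),y)\in\{0,1\}^{\mathcal M}\times\{0,1\}^{V\times A}: T\text{ tournament},\ y\ge\psi(T)\}$. An inequality is facet-defining for a polytope if it is valid and the face it induces is a facet. *)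

theory Defs
  imports "HOL-Analysis.Analysis"
begin

text \<open>
  The teams \<open>V\<close> are the elements of a finite type \<open>'v\<close> with \<open>CARD('v) = n\<close>, and the slots \<open>S\<close>
  are the elements of a finite linear order \<open>'s\<close> with \<open>CARD('s) = 2 * n - 2\<close>; the function
  \<open>slot_number\<close> numbers the slots \<open>1, \<dots>, CARD('s)\<close>.

  The ambient spaces of the vectors \<open>x\<close> and \<open>y\<close> have coordinates for all of \<open>S \<times> V \<times> V\<close> and
  \<open>V \<times> V \<times> V\<close>. The coordinates outside \<open>\<M>\<close> and \<open>V \<times> A\<close> (those with \<open>i = j\<close>) are \<open>0\<close> at all
  points considered, so that everything happens in a copy of \<open>\<real>\<^sup>\<M> \<times> \<real>\<^sup>V\<^sup>\<times>\<^sup>A\<close>, and affine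
  dimensions, faces and facets are unaffected.
\<close>

type_synonym ('s, 'v) match = "'s \<times> 'v \<times> 'v"

definition slot_number :: "'s::{finite,linorder} \<Rightarrow> nat" where
  "slot_number k = card {l. l \<le> k}"

definition arcs :: "('v \<times> 'v) set" where
  "arcs = {(i, j). i \<noteq> j}"

definition matches :: "('s, 'v) match set" where
  "matches = UNIV \<times> arcs"

definition incidence_vector :: "'a::finite set \<Rightarrow> real ^ 'a" where
  "incidence_vector B = (\<chi> a. if a \<in> B then 1 else 0)"

definition is_tournament :: "('s::{finite,linorder}, 'v::finite) match set \<Rightarrow> bool" where
  "is_tournament T \<longleftrightarrow> T \<subseteq> matches \<and>
     (let x = incidence_vector T in
        (\<forall>k i. 2 \<le> slot_number k \<longrightarrow> (\<Sum>j \<in> UNIV - {i}. x $ (k, i, j) + x $ (k, j, i)) = 1) \<and>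
        (\<forall>(i, j) \<in> arcs. (\<Sum>k \<in> UNIV. x $ (k, i, j)) = 1))"

text \<open>
  Team \<open>t\<close> is at venue \<open>i\<close> at position \<open>p\<close>, where position \<open>0\<close> is the start, positions
  \<open>1, \<dots>, CARD('s)\<close> are the slots and position \<open>CARD('s) + 1\<close> is the end.
\<close>

definition at_venue :: "('s::{finite,linorder}, 'v) match set \<Rightarrow> 'v \<Rightarrow> nat \<Rightarrow> 'v \<Rightarrow> bool" where
  "at_venue T t p i \<longleftrightarrow>
     (if p = 0 \<or> p = CARD('s) + 1 then i = t
      else \<exists>k. slot_number k = p \<and> (i = t \<and> (\<exists>j. (k, t, j) \<in> T) \<or> (k, i, t) \<in> T))"

definition travels :: "('s::{finite,linorder}, 'v) match set \<Rightarrow> 'v \<Rightarrow> 'v \<Rightarrow> 'v \<Rightarrow> bool" where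
  "travels T t i j \<longleftrightarrow>
     i \<noteq> j \<and> (\<exists>p \<le> CARD('s). at_venue T t p i \<and> at_venue T t (p + 1) j)"

definition travel_vector ::
    "('s::{finite,linorder}, 'v::finite) match set \<Rightarrow> real ^ ('v \<times> 'v \<times> 'v)" where
  "travel_vector T = incidence_vector {(t, i, j). travels T t i j}"

definition utt_polytope ::
    "((real ^ ('s::{finite,linorder} \<times> 'v::finite \<times> 'v)) \<times> (real ^ ('v \<times> 'v \<times> 'v))) set" where
  "utt_polytope = convex hull
     {(incidence_vector T, y) | T y.
        is_tournament T \<and>
        (\<forall>t i j. if (i, j) \<in> arcs then y $ (t, i, j) \<in> {0, 1} else y $ (t, i, j) = 0) \<and>
        (\<forall>t. \<forall>(i, j) \<in> arcs. y $ (t, i, j) \<ge> travel_vector T $ (t, i, j))}"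

text \<open>The linear inequality \<open>a \<bullet> z \<ge> b\<close> is facet-defining for \<open>P\<close>.\<close>

definition facet_defining_ge :: "'a::euclidean_space \<Rightarrow> real \<Rightarrow> 'a set \<Rightarrow> bool" where
  "facet_defining_ge a b P \<longleftrightarrow>
     (\<forall>z \<in> P. a \<bullet> z \<ge> b) \<and> {z \<in> P. a \<bullet> z = b} facet_of P"

text \<open>The coefficient vector \<open>a\<close> with \<open>a \<bullet> (x, y) = x $ m\<close>.\<close>

definition match_coeff :: "('s::finite, 'v::finite) match \<Rightarrow>
    (real ^ ('s \<times> 'v \<times> 'v)) \<times> (real ^ ('v \<times> 'v \<times> 'v))" where
  "match_coeff m = (axis m 1, 0)"

lemma match_coeff_inner: "match_coeff m \<bullet> (x, y) = x $ m"
  by (simp add: match_coeff_def inner_axis')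

end

theory Submission
  imports Defs "HOL-Number_Theory.Cong"
begin

text \<open>
  It suffices that a linear functional which is constant on the face and takes the same value at
  one tournament containing the match \<open>(k, i, j)\<close> is constant on all vertices. Its travel part
  vanishes: for every team and every trip there is a tournament on the face in which the team does
  not make that trip, so the corresponding coordinate of \<open>y\<close> is free. For the match part \<open>w\<close> only
  tournaments built from two edge colourings \<open>f\<close>, \<open>g\<close> of the complete graph and an orientation are
  compared. Exchanging the venues of the two matches between \<open>i\<close> and \<open>j\<close> shows that
  \<open>w (k, i, j) - w (k, j, i)\<close> does not depend on the slot \<open>k\<close>. Hence \<open>D = w (k, _, _) - w (l, _, _)\<close>
  is symmetric, and exchanging the slots \<open>k\<close> and \<open>l\<close>, whose perfect matchings differ exactly on a
  4-cycle, yields \<open>D a b + D c d = D b c + D d a\<close>; so \<open>D a b = \<alpha> a + \<alpha> b\<close>. With \<open>l\<close> the first slot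
  this makes \<open>w\<close> a combination of the equations in the definition of a tournament.
\<close>


section \<open>Partial bijections, and affine hulls by duality\<close>

lemma bij_betw_extend:
  assumes "finite A" "finite B" "card A = card B"
    and "C \<subseteq> A" "inj_on f C" "f ` C \<subseteq> B"
  obtains g where "bij_betw g A B" "\<And>x. x \<in> C \<Longrightarrow> g x = f x"
proof -
  have "finite C" using assms(1,4) by (rule rev_finite_subset)
  then have "card (A - C) = card (B - f ` C)"
    using assms by (simp add: card_Diff_subset card_image)
  then obtain g where g: "bij_betw g (A - C) (B - f ` C)"
    using assms(1,2) finite_same_card_bij[of "A - C" "B - f ` C"] by auto
  let ?h = "\<lambda>x. if x \<in> C then f x else g x"
  have "bij_betw ?h (C \<union> (A - C)) (f ` C \<union> (B - f ` C))"
  proof (rule bij_betw_combine)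
    show "bij_betw ?h C (f ` C)"
      using assms(5) by (simp add: bij_betw_def inj_on_def)
    show "bij_betw ?h (A - C) (B - f ` C)"
      by (rule bij_betw_cong[THEN iffD1, OF _ g]) simp
  qed blast
  moreover have "C \<union> (A - C) = A" "f ` C \<union> (B - f ` C) = B" using assms by auto
  ultimately have "bij_betw ?h A B" by simp
  then show ?thesis by (rule that) simp
qed

text \<open>After translation by a point \<open>s\<close> of \<open>S\<close>, the functionals
  constant on \<open>S\<close> are those orthogonal to all differences \<open>x - s\<close>, and a
  subspace is its own double orthogonal complement.\<close>

lemma mem_affine_hull_if_functionals:
  fixes S :: "'a::euclidean_space set"
  assumes "S \<noteq> {}"
    and functional: "\<And>a b. (\<And>x. x \<in> S \<Longrightarrow> a \<bullet> x = b) \<Longrightarrow> a \<bullet> z = b"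
  shows "z \<in> affine hull S"
proof -
  obtain s where s: "s \<in> S" using assms by auto
  let ?W = "span ((\<lambda>x. x - s) ` S)"
  have "z - s \<in> orthogonal_comp (orthogonal_comp ?W)"
    unfolding orthogonal_comp_def
  proof (clarsimp simp: orthogonal_def)
    fix a assume a: "\<forall>w\<in>?W. w \<bullet> a = 0"
    have "a \<bullet> x = a \<bullet> s" if "x \<in> S" for x
    proof -
      have "a \<bullet> (x - s) = 0" using a span_base[OF imageI[OF that]] by (metis inner_commute)
      then show ?thesis by (simp add: inner_diff_right)
    qed
    then have "a \<bullet> z = a \<bullet> s" by (rule functional)
    then show "a \<bullet> (z - s) = 0" by (simp add: inner_diff_right)
  qed
  then have "z - s \<in> ?W" by (simp add: orthogonal_comp_self subspace_span)
  \<comment> \<open>\<open>affine_hull_span2\<close> leaves out \<open>s\<close> itself, which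
    contributes only the zero difference.\<close>
  moreover have "?W = span ((\<lambda>x. x - s) ` (S - {s}))"
  proof -
    have "(\<lambda>x. x - s) ` S = insert 0 ((\<lambda>x. x - s) ` (S - {s}))" using s by auto
    then show ?thesis by simp
  qed
  ultimately have "z - s \<in> span ((\<lambda>x. x - s) ` (S - {s}))" by simp
  then show ?thesis
    unfolding affine_hull_span2[OF s] uminus_add_conv_diff
    by (rule rev_image_eqI) simp
qed

section \<open>Numbering of the slots\<close>

lemma slot_number_pos: "1 \<le> slot_number k"
proof -
  have "k \<in> {l. l \<le> k}" by simp
  then have "{l. l \<le> k} \<noteq> {}" by blast
  then show ?thesis unfolding slot_number_def by (simp add: Suc_le_eq card_gt_0_iff)
qed

lemma slot_number_le: "slot_number (k :: 's::{finite,linorder}) \<le> CARD('s)"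
  unfolding slot_number_def by (intro card_mono) auto

lemma strict_mono_slot_number: "strict_mono slot_number"
  unfolding strict_mono_def slot_number_def
proof (intro allI impI psubset_card_mono)
  fix x y :: 'a assume "x < y"
  then have "y \<in> {l. l \<le> y} - {l. l \<le> x}" "{l. l \<le> x} \<subseteq> {l. l \<le> y}" by auto
  then show "{l. l \<le> x} \<subset> {l. l \<le> y}" by blast
qed simp

lemma inj_slot_number: "inj slot_number"
  using strict_mono_slot_number by (rule strict_mono_imp_inj_on)

lemma range_slot_number: "range (slot_number :: 's::{finite,linorder} \<Rightarrow> nat) = {1..CARD('s)}"
proof (rule card_subset_eq)
  show "range (slot_number :: 's \<Rightarrow> nat) \<subseteq> {1..CARD('s)}"
    using slot_number_le slot_number_pos by (auto simp del: One_nat_def)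
  show "card (range (slot_number :: 's \<Rightarrow> nat)) = card {1..CARD('s)}"
    by (simp add: card_image inj_slot_number)
qed simp

section \<open>Proper edge colourings of the complete graph\<close>

text \<open>Diagonal values \<open>f i i\<close> are unconstrained, so that a colouring can be a
  total function.\<close>

definition edge_coloring :: "('v \<Rightarrow> 'v \<Rightarrow> 'c) \<Rightarrow> bool" where
  "edge_coloring f \<longleftrightarrow> (\<forall>i j. f i j = f j i) \<and>
     (\<forall>i j j'. i \<noteq> j \<longrightarrow> i \<noteq> j' \<longrightarrow> f i j = f i j' \<longrightarrow> j = j')"

lemma edge_coloring_commute: "edge_coloring f \<Longrightarrow> f i j = f j i"
  by (simp add: edge_coloring_def)

lemma edge_coloring_inj:
  "edge_coloring f \<Longrightarrow> f i j = f i j' \<Longrightarrow> i \<noteq> j \<Longrightarrow> i \<noteq> j' \<Longrightarrow> j = j'"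
  unfolding edge_coloring_def by blast

lemma edge_coloring_inj':
  "edge_coloring f \<Longrightarrow> f j i = f j' i \<Longrightarrow> i \<noteq> j \<Longrightarrow> i \<noteq> j' \<Longrightarrow> j = j'"
  using edge_coloring_inj[of f i j j'] edge_coloring_commute[of f j i]
    edge_coloring_commute[of f j' i] by simp

lemma edge_coloring_comp:
  assumes "edge_coloring f" "inj \<pi>"
  shows "edge_coloring (\<lambda>i j. f (\<pi> i) (\<pi> j))"
  unfolding edge_coloring_def
proof (intro conjI allI impI)
  fix i j j'
  assume "i \<noteq> j" "i \<noteq> j'" "f (\<pi> i) (\<pi> j) = f (\<pi> i) (\<pi> j')"
  then have "\<pi> j = \<pi> j'"
    using injD[OF assms(2)] by (intro edge_coloring_inj[OF assms(1)]) blast+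
  then show "j = j'" by (rule injD[OF assms(2)])
qed (rule edge_coloring_commute[OF assms(1)])

text \<open>The circle method: colour \<open>i + j\<close> modulo the odd number \<open>N\<close>, where the vertex \<open>N\<close> takes the
  place of the fixed point of \<open>j \<mapsto> c - j\<close>.\<close>

definition circle_color :: "nat \<Rightarrow> nat \<Rightarrow> nat \<Rightarrow> nat" where
  "circle_color N i j = (if i = N then 2 * j else if j = N then 2 * i else i + j) mod N"

lemma circle_color_commute: "circle_color N i j = circle_color N j i"
  by (simp add: circle_color_def add.commute)

lemma mod_mult_left_cancel:
  fixes i j j' N :: nat
  assumes "(m * j + i) mod N = (m * j' + i) mod N" "j < N" "j' < N" "coprime m N"
  shows "j = j'"
proof -
  have "[m * j + i = m * j' + i] (mod N)" using assms(1) by (simp add: cong_def)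
  then have "[m * j = m * j'] (mod N)" by (simp add: cong_add_rcancel_nat)
  then have "[j = j'] (mod N)" using assms(4) by (simp add: cong_mult_lcancel_nat)
  then show ?thesis using assms(2,3) by (simp add: cong_def)
qed

text \<open>At \<open>i = N\<close> the colours are doubled labels, and 2 is invertible modulo the
  odd \<open>N\<close>. At \<open>i < N\<close> the vertex \<open>N\<close> receives
  \<open>2 * i\<close>, the one value of \<open>i + j\<close> left free by
  \<open>j \<noteq> i\<close>, so translation can be cancelled.\<close>

lemma circle_color_inj:
  assumes "odd N" "i \<le> N" "j \<le> N" "j' \<le> N" "i \<noteq> j" "i \<noteq> j'"
    and eq: "circle_color N i j = circle_color N i j'"
  shows "j = j'"
proof (cases "i = N")
  case True
  then show ?thesis using assms mod_mult_left_cancel[of 2 j 0 N j']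
    by (auto simp: circle_color_def)
next
  case False
  have shift: "x = y" if "(i + x) mod N = (i + y) mod N" "x < N" "y < N" for x y
    using that mod_mult_left_cancel[of 1 x i N y] by (simp add: add.commute)
  consider "j = N" "j' = N" | "j = N" "j' < N" | "j < N" "j' = N" | "j < N" "j' < N"
    using assms by linarith
  then show ?thesis
  proof cases
    case 2
    then have "(i + i) mod N = (i + j') mod N"
      using eq False by (simp add: circle_color_def flip: mult_2)
    then show ?thesis using shift[of i j'] 2 False assms by simp
  next
    case 3
    then have "(i + j) mod N = (i + i) mod N"
      using eq False by (simp add: circle_color_def flip: mult_2)
    then show ?thesis using shift[of j i] 3 False assms by simp
  next
    case 4
    then show ?thesis using shift[of j j'] eq False by (simp add: circle_color_def)
  qed simp
qed

lemma obtain_edge_coloring: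
  fixes a b c d :: "'v::finite"
  assumes "4 \<le> CARD('v)" "even CARD('v)" "distinct [a, b, c, d]"
  obtains col :: "'v \<Rightarrow> 'v \<Rightarrow> nat" where "edge_coloring col"
    "\<And>i j. col i j < CARD('v) - 1" "col a b = col c d"
proof -
  define N where "N = CARD('v) - 1"
  have N: "3 \<le> N" "odd N" "CARD('v) = Suc N" using assms by (auto simp: N_def)
  then have N': "N - 1 \<noteq> N" "N - 1 \<noteq> 1" "N - 1 \<noteq> 0" "N \<noteq> 1" "N \<noteq> 0" "1 \<le> N" by auto
  \<comment> \<open>With these labels both prescribed edges get colour 0: the edge from 0 to
    \<open>N\<close> has colour \<open>2 * 0\<close>, and \<open>1 + (N - 1)\<close> vanishes modulo
    \<open>N\<close>.\<close>
  let ?f = "\<lambda>x. if x = a then 0 else if x = b then N else if x = c then 1 else N - 1"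
  obtain \<rho> where \<rho>: "bij_betw \<rho> (UNIV :: 'v set) {..N}" "\<And>x. x \<in> {a, b, c, d} \<Longrightarrow> \<rho> x = ?f x"
  proof (rule bij_betw_extend[of UNIV "{..N}" "{a, b, c, d}" ?f])
    show "inj_on ?f {a, b, c, d}" using assms(3) N' by (auto simp: inj_on_def)
    show "?f ` {a, b, c, d} \<subseteq> {..N}" using N' by auto
  qed (use N in auto)
  have le: "\<rho> i \<le> N" for i using \<rho>(1) by (auto simp: bij_betw_def)
  have inj: "\<rho> i = \<rho> j \<longleftrightarrow> i = j" for i j using \<rho>(1) by (auto simp: bij_betw_def inj_def)
  show ?thesis
  proof
    show "edge_coloring (\<lambda>i j. circle_color N (\<rho> i) (\<rho> j))"
      unfolding edge_coloring_def
    proof (intro conjI allI impI)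
      fix i j j'
      assume "i \<noteq> j" "i \<noteq> j'"
        and "circle_color N (\<rho> i) (\<rho> j) = circle_color N (\<rho> i) (\<rho> j')"
      then have "\<rho> j = \<rho> j'"
        by (intro circle_color_inj[OF N(2) le le le]) (auto simp: inj)
      then show "j = j'" by (simp add: inj)
    qed (rule circle_color_commute)
    show "circle_color N (\<rho> i) (\<rho> j) < CARD('v) - 1" for i j
      using N by (simp add: circle_color_def)
    show "circle_color N (\<rho> a) (\<rho> b) = circle_color N (\<rho> c) (\<rho> d)"
    proof -
      have "\<rho> a = 0" "\<rho> b = N" "\<rho> c = 1" "\<rho> d = N - 1" using \<rho>(2) assms(3) by auto
      then show ?thesis using N N' by (simp add: circle_color_def)
    qed
  qed
qed

section \<open>Tournaments from two edge colourings and an orientation\<close>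

definition schedule :: "('v \<Rightarrow> 'v \<Rightarrow> 's) \<Rightarrow> ('v \<Rightarrow> 'v \<Rightarrow> 's) \<Rightarrow> bool" where
  "schedule f g \<longleftrightarrow> edge_coloring f \<and> edge_coloring g \<and>
     (\<forall>i j i' j'. i \<noteq> j \<longrightarrow> i' \<noteq> j' \<longrightarrow> f i j \<noteq> g i' j')"

definition orientation :: "('v \<Rightarrow> 'v \<Rightarrow> bool) \<Rightarrow> bool" where
  "orientation h \<longleftrightarrow> (\<forall>i j. i \<noteq> j \<longrightarrow> (h i j \<longleftrightarrow> \<not> h j i))"

text \<open>Teams \<open>i\<close> and \<open>j\<close> meet in the slots \<open>f i j\<close> and
  \<open>g i j\<close>; \<open>h i j\<close> says that the meeting in slot \<open>f i j\<close> is
  at venue \<open>i\<close>.\<close>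

definition slot_of :: "('v \<Rightarrow> 'v \<Rightarrow> 's) \<Rightarrow> ('v \<Rightarrow> 'v \<Rightarrow> 's) \<Rightarrow> ('v \<Rightarrow> 'v \<Rightarrow> bool) \<Rightarrow> 'v \<Rightarrow> 'v \<Rightarrow> 's" where
  "slot_of f g h i j = (if h i j then f i j else g i j)"

definition tour :: "('v \<Rightarrow> 'v \<Rightarrow> 's) \<Rightarrow> ('v \<Rightarrow> 'v \<Rightarrow> 's) \<Rightarrow> ('v \<Rightarrow> 'v \<Rightarrow> bool) \<Rightarrow> ('s, 'v) match set" where
  "tour f g h = {(k, i, j). i \<noteq> j \<and> k = slot_of f g h i j}"

text \<open>Testing the unordered pair negates \<open>h i j\<close> and \<open>h j i\<close>
  together, which preserves orientations and exchanges the venues of the two meetings of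
  \<open>i\<close> and \<open>j\<close>.\<close>

definition flip :: "'v \<Rightarrow> 'v \<Rightarrow> ('v \<Rightarrow> 'v \<Rightarrow> bool) \<Rightarrow> 'v \<Rightarrow> 'v \<Rightarrow> bool" where
  "flip i j h x y = (if {x, y} = {i, j} then \<not> h x y else h x y)"

lemma scheduleD:
  assumes "schedule f g"
  shows "edge_coloring f" "edge_coloring g" "i \<noteq> j \<Longrightarrow> i' \<noteq> j' \<Longrightarrow> f i j \<noteq> g i' j'"
  using assms by (simp_all add: schedule_def)

lemma schedule_comp:
  assumes "schedule f g" "inj \<tau>"
  shows "schedule (\<lambda>i j. \<tau> (f i j)) (\<lambda>i j. \<tau> (g i j))"
  using assms(1) unfolding schedule_def edge_coloring_def inj_eq[OF assms(2)] .

lemma orientationD: "orientation h \<Longrightarrow> i \<noteq> j \<Longrightarrow> h i j \<longleftrightarrow> \<not> h j i"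
  unfolding orientation_def by blast

lemma orientation_Not: "orientation h \<Longrightarrow> orientation (\<lambda>i j. \<not> h i j)"
  unfolding orientation_def by blast

lemma orientation_flip:
  assumes "orientation h"
  shows "orientation (flip i j h)"
  unfolding orientation_def
proof (intro allI impI)
  fix x y :: 'a assume "x \<noteq> y"
  moreover have "{y, x} = {x, y}" by auto
  ultimately show "flip i j h x y \<longleftrightarrow> \<not> flip i j h y x"
    using orientationD[OF assms, of x y] by (simp add: flip_def)
qed

lemma obtain_orientation:
  fixes R :: "('v::finite \<times> 'v) set"
  assumes "\<And>i j. (i, j) \<in> R \<Longrightarrow> (j, i) \<notin> R"
  obtains h where "orientation h" "\<And>i j. (i, j) \<in> R \<Longrightarrow> h i j"
proof -
  obtain e :: "'v \<Rightarrow> nat" where e: "inj e"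
    using finite_imp_inj_to_nat_seg[of "UNIV :: 'v set"] by auto
  \<comment> \<open>Pairs not settled by \<open>R\<close> are directed by an arbitrary injection
    into the naturals.\<close>
  let ?h = "\<lambda>i j. (i, j) \<in> R \<or> (j, i) \<notin> R \<and> e i < e j"
  have "orientation ?h"
    unfolding orientation_def
  proof (intro allI impI)
    fix i j :: 'v assume "i \<noteq> j"
    then have "e i \<noteq> e j" using injD[OF e] by blast
    then show "?h i j \<longleftrightarrow> \<not> ?h j i" using assms[of i j] by (cases "e i < e j") auto
  qed
  then show ?thesis by (rule that) blast
qed

text \<open>The orientation only decides which venue gets which of the two slots of a pair.\<close>

lemma slot_of_pair:
  assumes "schedule f g" "orientation h" "i \<noteq> j"
  shows "of_bool (slot_of f g h i j = k) + of_bool (slot_of f g h j i = k)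
       = (of_bool (f i j = k) + of_bool (g i j = k) :: real)"
  using orientationD[OF assms(2,3)] edge_coloring_commute[OF scheduleD(1)[OF assms(1)], of i j]
    edge_coloring_commute[OF scheduleD(2)[OF assms(1)], of i j]
  by (simp add: slot_of_def)

lemma sum_edge_coloring:
  assumes "edge_coloring f" "i \<noteq> (j :: 'v::finite)"
  shows "(\<Sum>j' \<in> UNIV - {i}. of_bool (f i j' = f i j)) = (1 :: real)"
proof -
  have "(\<Sum>j' \<in> UNIV - {i}. of_bool (f i j' = f i j)) = (\<Sum>j' \<in> UNIV - {i}. of_bool (j' = j) :: real)"
    by (rule sum.cong) (use assms(2) edge_coloring_inj[OF assms(1), of i _ j] in auto)
  also have "\<dots> = 1"
    using assms(2) by (simp add: of_bool_def)
  finally show ?thesis .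
qed

text \<open>The n - 1 colours of \<open>f\<close> and the n - 1 colours of \<open>g\<close> at a
  team are all distinct, and there are just 2n - 2 slots, so the team plays exactly once in each
  slot.\<close>

lemma is_tournament_tour:
  fixes f g :: "'v::finite \<Rightarrow> 'v \<Rightarrow> 's::{finite,linorder}"
  assumes "CARD('s) = 2 * CARD('v) - 2" "schedule f g" "orientation h"
  shows "is_tournament (tour f g h)"
proof -
  note sch = scheduleD[OF assms(2)]
  let ?x = "incidence_vector (tour f g h)"
  have x: "?x $ (k, i, j) = of_bool (slot_of f g h i j = k)" if "i \<noteq> j" for k i j
    using that by (auto simp: incidence_vector_def tour_def)
  have "(\<Sum>j \<in> UNIV - {i}. ?x $ (k, i, j) + ?x $ (k, j, i)) = 1" for k i
  proof -
    let ?U = "UNIV - {i}"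
    have "f i x \<noteq> g i y" if "x \<in> ?U" "y \<in> ?U" for x y
      using that sch(3)[of i x i y] by auto
    then have "card (f i ` ?U \<union> g i ` ?U) = card (f i ` ?U) + card (g i ` ?U)"
      by (intro card_Un_disjoint) auto
    also have "card (f i ` ?U) = card ?U"
      by (intro card_image inj_onI) (use edge_coloring_inj[OF sch(1), of i] in blast)
    also have "card (g i ` ?U) = card ?U"
      by (intro card_image inj_onI) (use edge_coloring_inj[OF sch(2), of i] in blast)
    finally have "f i ` ?U \<union> g i ` ?U = UNIV"
      using assms(1) by (intro card_subset_eq) (simp_all add: card_Diff_subset)
    then consider j where "j \<noteq> i" "k = f i j" | j where "j \<noteq> i" "k = g i j" by blast
    then have "(\<Sum>j \<in> ?U. of_bool (f i j = k)) + (\<Sum>j \<in> ?U. of_bool (g i j = k)) = (1 :: real)"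
    proof cases
      case 1
      have "g i j' \<noteq> k" if "j' \<in> ?U" for j' using 1 that sch(3)[of i j i j'] by auto
      then show ?thesis using sum_edge_coloring[OF sch(1)] 1 by simp
    next
      case 2
      have "f i j' \<noteq> k" if "j' \<in> ?U" for j' using 2 that sch(3)[of i j' i j] by auto
      then show ?thesis using sum_edge_coloring[OF sch(2)] 2 by simp
    qed
    moreover have "(\<Sum>j \<in> ?U. ?x $ (k, i, j) + ?x $ (k, j, i))
        = (\<Sum>j \<in> ?U. of_bool (f i j = k) + of_bool (g i j = k))"
      by (rule sum.cong) (auto simp: x slot_of_pair[OF assms(2,3)])
    ultimately show ?thesis by (simp add: sum.distrib)
  qed
  moreover have "(\<Sum>k \<in> UNIV. ?x $ (k, i, j)) = 1" if "i \<noteq> j" for i j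
    using that by (simp add: x of_bool_def)
  ultimately show ?thesis
    by (auto simp: is_tournament_def Let_def arcs_def matches_def tour_def)
qed

lemma inner_tour:
  fixes c :: "real ^ ('s::finite \<times> 'v::finite \<times> 'v)"
  shows "c \<bullet> incidence_vector (tour f g h) = (\<Sum>(i, j) \<in> arcs. c $ (slot_of f g h i j, i, j))"
proof -
  let ?e = "\<lambda>(i, j). (slot_of f g h i j, i, j)"
  have "c \<bullet> incidence_vector (tour f g h) = (\<Sum>m \<in> UNIV. if m \<in> tour f g h then c $ m else 0)"
    unfolding inner_vec_def by (rule sum.cong) (auto simp: incidence_vector_def)
  also have "\<dots> = (\<Sum>m \<in> tour f g h. c $ m)" by (simp add: sum.If_cases)
  also have "\<dots> = (\<Sum>m \<in> ?e ` arcs. c $ m)"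
    by (rule sum.cong) (auto simp: tour_def arcs_def image_iff)
  also have "\<dots> = (\<Sum>a \<in> arcs. c $ ?e a)"
    by (subst sum.reindex) (auto simp: inj_on_def)
  also have "\<dots> = (\<Sum>(i, j) \<in> arcs. c $ (slot_of f g h i j, i, j))"
    by (rule sum.cong) auto
  finally show ?thesis .
qed

text \<open>Only the two matches between \<open>i\<close> and \<open>j\<close> move; all other terms
  of the sum over arcs cancel.\<close>

lemma inner_tour_flip:
  fixes c :: "real ^ ('s::finite \<times> 'v::finite \<times> 'v)"
  assumes "schedule f g" "orientation h" "h i j" "i \<noteq> j"
  shows "c \<bullet> incidence_vector (tour f g h) - c \<bullet> incidence_vector (tour f g (flip i j h))
       = c $ (f i j, i, j) + c $ (g i j, j, i) - c $ (g i j, i, j) - c $ (f i j, j, i)"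
proof -
  let ?s = "slot_of f g h" and ?s' = "slot_of f g (flip i j h)"
  have eq: "?s x y = ?s' x y" if "(x, y) \<notin> {(i, j), (j, i)}" for x y
    using that by (auto simp: slot_of_def flip_def doubleton_eq_iff)
  have "\<not> h j i" using orientationD[OF assms(2,4)] assms(3) by simp
  then have s: "?s i j = f i j" "?s j i = g i j" "?s' i j = g i j" "?s' j i = f i j"
    using assms(3) edge_coloring_commute[OF scheduleD(1)[OF assms(1)], of i j]
      edge_coloring_commute[OF scheduleD(2)[OF assms(1)], of i j]
    by (auto simp: slot_of_def flip_def doubleton_eq_iff)
  have arcs: "{(i, j), (j, i)} \<subseteq> arcs" using assms(4) by (auto simp: arcs_def)
  have "c \<bullet> incidence_vector (tour f g h) - c \<bullet> incidence_vector (tour f g (flip i j h))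
      = (\<Sum>(x, y) \<in> arcs. c $ (?s x y, x, y) - c $ (?s' x y, x, y))"
    by (simp add: inner_tour sum_subtractf case_prod_unfold)
  also have "\<dots> = (\<Sum>(x, y) \<in> {(i, j), (j, i)}. c $ (?s x y, x, y) - c $ (?s' x y, x, y))"
  proof (rule sum.mono_neutral_right[OF _ arcs])
    show "\<forall>a \<in> arcs - {(i, j), (j, i)}. (case a of (x, y) \<Rightarrow> c $ (?s x y, x, y) - c $ (?s' x y, x, y)) = 0"
    proof
      fix a assume "a \<in> arcs - {(i, j), (j, i)}"
      then show "(case a of (x, y) \<Rightarrow> c $ (?s x y, x, y) - c $ (?s' x y, x, y)) = 0"
        using eq[of "fst a" "snd a"] by (simp add: case_prod_beta)
    qed
  qed simp
  also have "\<dots> = c $ (f i j, i, j) + c $ (g i j, j, i) - c $ (g i j, i, j) - c $ (f i j, j, i)"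
    using assms(4) by (simp add: s)
  finally show ?thesis .
qed

text \<open>The offset \<open>N\<close> makes the two palettes disjoint before
  \<open>\<sigma>\<close> turns colours into slots.\<close>

lemma schedule_of_edge_colorings:
  fixes N :: nat
  assumes "edge_coloring col" "edge_coloring col'" "\<And>i j. col i j < N" "\<And>i j. col' i j < N"
    and \<sigma>: "inj_on \<sigma> {..<2 * N}"
  shows "schedule (\<lambda>i j. \<sigma> (col i j)) (\<lambda>i j. \<sigma> (N + col' i j))"
proof -
  have eq: "\<sigma> x = \<sigma> y \<longleftrightarrow> x = y" if "x < 2 * N" "y < 2 * N" for x y
    using inj_on_eq_iff[OF \<sigma>] that by simp
  have bds: "col i j < 2 * N" "N + col' i j < 2 * N" "col i j \<noteq> N + col' i' j'" for i j i' j'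
    using assms(3)[of i j] assms(4)[of i j] by auto
  show ?thesis
    unfolding schedule_def edge_coloring_def eq[OF bds(1) bds(1)] eq[OF bds(2) bds(2)]
      eq[OF bds(1) bds(2)] add_left_cancel
    using assms(1,2) bds(3) unfolding edge_coloring_def by blast
qed

section \<open>Schedules with prescribed slots\<close>

text \<open>The \<open>itself\<close> parameters only carry the types of slots and teams into the
  locale.\<close>

locale tournament_size =
  fixes slots :: "'s::{finite,linorder} itself" and teams :: "'v::finite itself"
  assumes card_teams: "4 \<le> CARD('v)" "even CARD('v)"
    and card_slots: "CARD('s) = 2 * CARD('v) - 2"
begin

lemma ex_teams_distinct:
  fixes B :: "'v set"
  assumes "card B < 4"
  obtains x where "x \<notin> B"
proof -
  have "B \<noteq> UNIV" using assms card_teams(1) by auto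
  then show ?thesis using that by blast
qed

lemma obtain_slot_enumeration:
  fixes \<phi> :: "nat \<Rightarrow> 's"
  assumes "C \<subseteq> {..<2 * (CARD('v) - 1)}" "inj_on \<phi> C"
  obtains \<sigma> where "inj_on \<sigma> {..<2 * (CARD('v) - 1)}" "\<And>x. x \<in> C \<Longrightarrow> \<sigma> x = \<phi> x"
proof -
  have "card {..<2 * (CARD('v) - 1)} = CARD('s)" using card_slots by simp
  then obtain \<sigma> where \<sigma>: "bij_betw \<sigma> {..<2 * (CARD('v) - 1)} (UNIV :: 's set)"
      "\<And>x. x \<in> C \<Longrightarrow> \<sigma> x = \<phi> x"
    using bij_betw_extend[OF finite_lessThan finite _ assms subset_UNIV that] by blast
  show ?thesis by (rule that[OF bij_betw_imp_inj_on[OF \<sigma>(1)] \<sigma>(2)])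
qed

text \<open>One colouring serves for both halves of the season; \<open>p\<close> and
  \<open>q\<close> complete the four teams for \<open>obtain_edge_coloring\<close>.\<close>

lemma obtain_schedule_edge:
  fixes i j :: 'v and k l :: 's
  assumes "i \<noteq> j" "k \<noteq> l"
  obtains f g where "schedule f g" "f i j = k" "g i j = l"
proof -
  let ?N = "CARD('v) - 1"
  obtain p where p: "p \<notin> {i, j}"
    by (rule ex_teams_distinct[of "{i, j}"]) (auto simp: card_insert_if)
  obtain q where q: "q \<notin> {i, j, p}"
    by (rule ex_teams_distinct[of "{i, j, p}"]) (auto simp: card_insert_if)
  have dist: "distinct [i, j, p, q]" using assms(1) p q by auto
  obtain col :: "'v \<Rightarrow> 'v \<Rightarrow> nat" where col: "edge_coloring col" "\<And>i j. col i j < ?N"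
      "col i j = col p q"
    by (rule obtain_edge_coloring[OF card_teams dist that])
  let ?x = "col i j"
  have x: "?x < ?N" by (rule col(2))
  obtain \<sigma> :: "nat \<Rightarrow> 's" where \<sigma>: "inj_on \<sigma> {..<2 * ?N}"
    "\<And>y. y \<in> {?x, ?N + ?x} \<Longrightarrow> \<sigma> y = (if y = ?x then k else l)"
  proof (rule obtain_slot_enumeration[OF _ _ that])
    show "{?x, ?N + ?x} \<subseteq> {..<2 * ?N}" using x by auto
    show "inj_on (\<lambda>y. if y = ?x then k else l) {?x, ?N + ?x}"
      using assms(2) by (auto simp: inj_on_def)
  qed
  show ?thesis
  proof
    show "schedule (\<lambda>i j. \<sigma> (col i j)) (\<lambda>i j. \<sigma> (?N + col i j))"
      by (rule schedule_of_edge_colorings[OF col(1) col(1) col(2) col(2) \<sigma>(1)])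
    show "\<sigma> ?x = k" "\<sigma> (?N + ?x) = l" using \<sigma>(2)[of ?x] \<sigma>(2)[of "?N + ?x"] x by (simp_all split: if_splits)
  qed
qed

text \<open>The second colouring is the first with \<open>a\<close> and \<open>c\<close> exchanged.
  So the matching of slot \<open>l\<close> arises from that of slot \<open>k\<close> by replacing
  the edges ab, cd with cb, ad, and the two differ exactly in a 4-cycle.\<close>

lemma obtain_schedule_alternating:
  fixes a b c d :: 'v and k l :: 's
  assumes "distinct [a, b, c, d]" "k \<noteq> l"
  obtains f g where "schedule f g" "f a b = k" "f c d = k"
    "\<And>x y. g x y = l \<longleftrightarrow> f (Transposition.transpose a c x) (Transposition.transpose a c y) = k"
proof -
  let ?N = "CARD('v) - 1" and ?\<pi> = "Transposition.transpose a c"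
  obtain col :: "'v \<Rightarrow> 'v \<Rightarrow> nat" where col: "edge_coloring col" "\<And>i j. col i j < ?N"
      "col a b = col c d"
    by (rule obtain_edge_coloring[OF card_teams assms(1) that])
  let ?x = "col a b"
  have x: "?x < ?N" by (rule col(2))
  obtain \<sigma> :: "nat \<Rightarrow> 's" where \<sigma>: "inj_on \<sigma> {..<2 * ?N}"
    "\<And>y. y \<in> {?x, ?N + ?x} \<Longrightarrow> \<sigma> y = (if y = ?x then k else l)"
  proof (rule obtain_slot_enumeration[OF _ _ that])
    show "{?x, ?N + ?x} \<subseteq> {..<2 * ?N}" using x by auto
    show "inj_on (\<lambda>y. if y = ?x then k else l) {?x, ?N + ?x}"
      using assms(2) by (auto simp: inj_on_def)
  qed
  have eq: "\<sigma> y = \<sigma> z \<longleftrightarrow> y = z" if "y < 2 * ?N" "z < 2 * ?N" for y z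
    using inj_on_eq_iff[OF \<sigma>(1)] that by simp
  have k: "\<sigma> ?x = k" and l: "\<sigma> (?N + ?x) = l"
    using \<sigma>(2)[of ?x] \<sigma>(2)[of "?N + ?x"] x by (simp_all split: if_splits)
  have "edge_coloring (\<lambda>i j. col (?\<pi> i) (?\<pi> j))"
    by (rule edge_coloring_comp[OF col(1)]) simp
  then have sch: "schedule (\<lambda>i j. \<sigma> (col i j)) (\<lambda>i j. \<sigma> (?N + col (?\<pi> i) (?\<pi> j)))"
    by (rule schedule_of_edge_colorings[OF col(1) _ col(2) col(2) \<sigma>(1)])
  \<comment> \<open>The colours are below \<open>?N\<close> on the diagonal as well, so
    \<open>\<sigma>\<close> is injective on all numbers compared here.\<close>
  have iff: "\<sigma> (?N + col (?\<pi> y) (?\<pi> z)) = l \<longleftrightarrow> \<sigma> (col (?\<pi> y) (?\<pi> z)) = k" for y z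
  proof -
    let ?w = "col (?\<pi> y) (?\<pi> z)"
    have w: "?w < ?N" by (rule col(2))
    have "\<sigma> (?N + ?w) = \<sigma> (?N + ?x) \<longleftrightarrow> ?w = ?x"
      using eq[of "?N + ?w" "?N + ?x"] w x unfolding add_left_cancel by linarith
    moreover have "\<sigma> ?w = \<sigma> ?x \<longleftrightarrow> ?w = ?x" using eq[of ?w ?x] w x by linarith
    ultimately show ?thesis by (simp only: k l)
  qed
  show ?thesis by (rule that[OF sch]) (use k col(3) iff in auto)
qed

text \<open>This prepares consecutive away matches of \<open>t\<close> at \<open>u\<close> and
  \<open>v\<close>; keeping \<open>k\<^sub>3\<close> out of the second palette lets an orientation
  avoid a given match in that slot.\<close>

lemma obtain_schedule_path:
  fixes t u v :: 'v and k\<^sub>1 k\<^sub>2 k\<^sub>3 :: 's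
  assumes "distinct [t, u, v]" "distinct [k\<^sub>1, k\<^sub>2, k\<^sub>3]"
  obtains f g where "schedule f g" "f u t = k\<^sub>1" "f v t = k\<^sub>2" "\<And>x y. g x y \<noteq> k\<^sub>3"
proof -
  let ?N = "CARD('v) - 1"
  obtain p where p: "p \<notin> {t, u, v}"
    by (rule ex_teams_distinct[of "{t, u, v}"]) (auto simp: card_insert_if)
  have dist: "distinct [t, u, v, p]" using assms(1) p by auto
  obtain col :: "'v \<Rightarrow> 'v \<Rightarrow> nat" where col: "edge_coloring col" "\<And>i j. col i j < ?N"
      "col t u = col v p"
    by (rule obtain_edge_coloring[OF card_teams dist that])
  let ?x = "col u t" and ?y = "col v t"
  have "?x \<noteq> ?y" using edge_coloring_inj'[OF col(1), of u t v] assms(1) by auto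
  \<comment> \<open>There are at least three colours; the third one, \<open>z\<close>, receives
    \<open>k\<^sub>3\<close> and thereby puts it into the first palette.\<close>
  have "card {?x, ?y} < ?N" using card_teams by (auto simp: card_insert_if)
  then obtain z where z: "z < ?N" "z \<notin> {?x, ?y}"
    using card_mono[of "{?x, ?y}" "{..<?N}"] by (auto simp: subset_iff)
  let ?\<phi> = "\<lambda>w. if w = ?x then k\<^sub>1 else if w = ?y then k\<^sub>2 else k\<^sub>3"
  have xy: "?x < ?N" "?y < ?N" by (rule col(2))+
  obtain \<sigma> :: "nat \<Rightarrow> 's" where \<sigma>: "inj_on \<sigma> {..<2 * ?N}"
    "\<And>w. w \<in> {?x, ?y, z} \<Longrightarrow> \<sigma> w = ?\<phi> w"
  proof (rule obtain_slot_enumeration[OF _ _ that])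
    show "{?x, ?y, z} \<subseteq> {..<2 * ?N}" using xy z by auto
    show "inj_on ?\<phi> {?x, ?y, z}" using assms(2) z by (auto simp: inj_on_def)
  qed
  have \<sigma>': "\<sigma> ?x = k\<^sub>1" "\<sigma> ?y = k\<^sub>2" "\<sigma> z = k\<^sub>3" 
    using \<sigma>(2)[of ?x] \<sigma>(2)[of ?y] \<sigma>(2)[of z] \<open>?x \<noteq> ?y\<close> z by simp_all
  show ?thesis
  proof
    show "schedule (\<lambda>i j. \<sigma> (col i j)) (\<lambda>i j. \<sigma> (?N + col i j))"
      by (rule schedule_of_edge_colorings[OF col(1) col(1) col(2) col(2) \<sigma>(1)])
    show "\<sigma> (?N + col i j) \<noteq> k\<^sub>3" for i j
      using inj_onD[OF \<sigma>(1), of "?N + col i j" z] col(2)[of i j] z \<sigma>'(3) by auto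
  qed (fact \<sigma>')+
qed

end

section \<open>Additive functions and the value of a functional on tournaments\<close>

text \<open>The 4-cycle through \<open>p\<close>, \<open>j\<close>, \<open>i\<close>,
  \<open>j'\<close> says that the defect \<open>D p i + D p j - D i j\<close> does not change when
  \<open>j\<close> is replaced by \<open>j'\<close>. So the defect is constant away from
  \<open>p\<close>.\<close>

lemma additive_if_alternating_cycles:
  fixes D :: "'v \<Rightarrow> 'v \<Rightarrow> real" and p q r :: 'v
  assumes sym: "\<And>i j. D i j = D j i" and pqr: "distinct [p, q, r]"
    and cycle: "\<And>a b c d. distinct [a, b, c, d] \<Longrightarrow> D a b + D c d = D b c + D d a"
  obtains \<alpha> where "\<And>i j. i \<noteq> j \<Longrightarrow> D i j = \<alpha> i + \<alpha> j"
proof -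
  define h where "h i j = D p i + D p j - D i j" for i j
  have h_sym: "h i j = h j i" for i j by (simp add: h_def sym[of i j])
  have step: "h i j = h i j'" if "i \<noteq> p" "j \<noteq> p" "j' \<noteq> p" "i \<noteq> j" "i \<noteq> j'" for i j j'
  proof (cases "j = j'")
    case False
    then have "distinct [p, j, i, j']" using that by auto
    then show ?thesis using cycle[of p j i j'] by (simp add: h_def sym[of j' p] sym[of j i])
  qed simp
  \<comment> \<open>Endpoints are replaced one at a time; \<open>i = r\<close> is separate because
    \<open>j\<close> cannot then become \<open>r\<close>.\<close>
  have const: "h i j = h q r" if "i \<noteq> p" "j \<noteq> p" "i \<noteq> j" for i j
  proof (cases "i = r")
    case True
    then have "h i j = h r q" using step[of r j q] that pqr by auto
    then show ?thesis by (simp add: h_sym)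
  next
    case False
    then have "h i j = h i r" using step[of i j r] that pqr by auto
    also have "\<dots> = h r q" using step[of r i q] that pqr False by (auto simp: h_sym[of i r])
    finally show ?thesis by (simp add: h_sym)
  qed
  \<comment> \<open>Half the constant defect is subtracted at each endpoint other than
    \<open>p\<close> and restored at \<open>p\<close>.\<close>
  define s where "s = h q r / 2"
  have "D i j = (if i = p then s else D p i - s) + (if j = p then s else D p j - s)"
    if "i \<noteq> j" for i j
    using const[of i j] that sym[of p i] by (auto simp: s_def h_def)
  then show ?thesis by (rule that[of "\<lambda>i. if i = p then s else D p i - s"])
qed

text \<open>Including the vanishing diagonal lets the sums range over \<open>UNIV\<close>, so that
  they can be interchanged.\<close>

lemma tournament_sums:
  assumes "is_tournament T"
  shows "(k, i, i) \<notin> T"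
    and "2 \<le> slot_number k \<Longrightarrow>
      (\<Sum>j \<in> UNIV. incidence_vector T $ (k, i, j) + incidence_vector T $ (k, j, i)) = 1"
    and "i \<noteq> j \<Longrightarrow> (\<Sum>k \<in> UNIV. incidence_vector T $ (k, i, j)) = 1"
proof -
  have loop: "(k, i, i) \<notin> T" for k i
    using assms by (auto simp: is_tournament_def matches_def arcs_def)
  then show "(k, i, i) \<notin> T" .
  show "i \<noteq> j \<Longrightarrow> (\<Sum>k \<in> UNIV. incidence_vector T $ (k, i, j)) = 1"
    using assms by (auto simp: is_tournament_def Let_def arcs_def)
  assume "2 \<le> slot_number k"
  then have "(\<Sum>j \<in> UNIV - {i}. incidence_vector T $ (k, i, j) + incidence_vector T $ (k, j, i)) = 1"
    using assms by (simp add: is_tournament_def Let_def)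
  moreover have "incidence_vector T $ (k, i, i) = 0"
    using loop by (simp add: incidence_vector_def)
  ultimately show "(\<Sum>j \<in> UNIV. incidence_vector T $ (k, i, j) + incidence_vector T $ (k, j, i)) = 1"
    by (subst sum.remove[of _ i]) auto
qed

lemma sum_UNIV_triple:
  "(\<Sum>m \<in> UNIV. F m) = (\<Sum>k \<in> UNIV. \<Sum>i \<in> UNIV. \<Sum>j \<in> UNIV. F (k :: 's::finite, i :: 'v::finite, j :: 'w::finite))"
  by (simp add: sum.cartesian_product flip: UNIV_Times_UNIV)

text \<open>The part taken from slot \<open>l\<close> is evaluated by the equation of each arc, the
  \<open>\<alpha>\<close> part by the equations of the slots from 2 on, which are all slots except
  \<open>l\<close>.\<close>

lemma inner_tournament_potential:
  fixes c :: "real ^ ('s::{finite,linorder} \<times> 'v::finite \<times> 'v)"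
  assumes T: "is_tournament T" and l: "slot_number l = 1"
    and c: "\<And>k i j. k \<noteq> l \<Longrightarrow> i \<noteq> j \<Longrightarrow> c $ (k, i, j) = c $ (l, i, j) + \<alpha> k i + \<alpha> k j"
  shows "c \<bullet> incidence_vector T
       = (\<Sum>(i, j) \<in> arcs. c $ (l, i, j)) + (\<Sum>k \<in> UNIV - {l}. \<Sum>i \<in> UNIV. \<alpha> k i)"
proof -
  let ?x = "incidence_vector T"
  have loop: "?x $ (k, i, i) = 0" for k i
    using tournament_sums(1)[OF T] by (simp add: incidence_vector_def)
  \<comment> \<open>Extending \<open>\<alpha>\<close> by zero at \<open>l\<close> gives one formula
    for all slots; on the diagonal it holds because \<open>?x\<close> vanishes.\<close>
  define \<beta> where "\<beta> k i = (if k = l then 0 else \<alpha> k i)" for k i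
  have "c $ (k, i, j) * ?x $ (k, i, j)
      = c $ (l, i, j) * ?x $ (k, i, j) + (\<beta> k i * ?x $ (k, i, j) + \<beta> k j * ?x $ (k, i, j))" for k i j
    using c[of k i j] loop[of k i] by (cases "i = j"; cases "k = l") (auto simp: \<beta>_def algebra_simps)
  then have main: "c \<bullet> ?x = (\<Sum>k \<in> UNIV. \<Sum>i \<in> UNIV. \<Sum>j \<in> UNIV. c $ (l, i, j) * ?x $ (k, i, j))
      + (\<Sum>k \<in> UNIV. \<Sum>i \<in> UNIV. \<Sum>j \<in> UNIV. \<beta> k i * ?x $ (k, i, j) + \<beta> k j * ?x $ (k, i, j))"
    by (simp add: inner_vec_def sum_UNIV_triple sum.distrib)
  have "(\<Sum>k \<in> UNIV. \<Sum>i \<in> UNIV. \<Sum>j \<in> UNIV. c $ (l, i, j) * ?x $ (k, i, j))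
      = (\<Sum>i \<in> UNIV. \<Sum>j \<in> UNIV. c $ (l, i, j) * (\<Sum>k \<in> UNIV. ?x $ (k, i, j)))"
    by (subst sum.swap, rule sum.cong[OF refl], subst sum.swap) (simp add: sum_distrib_left)
  also have "\<dots> = (\<Sum>(i, j) \<in> UNIV. c $ (l, i, j) * (\<Sum>k \<in> UNIV. ?x $ (k, i, j)))"
    by (simp add: sum.cartesian_product)
  also have "\<dots> = (\<Sum>(i, j) \<in> arcs. c $ (l, i, j))"
    by (rule sum.mono_neutral_cong_right)
      (auto simp: arcs_def loop tournament_sums(3)[OF T])
  finally have A: "(\<Sum>k \<in> UNIV. \<Sum>i \<in> UNIV. \<Sum>j \<in> UNIV. c $ (l, i, j) * ?x $ (k, i, j))
      = (\<Sum>(i, j) \<in> arcs. c $ (l, i, j))" .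
  have B: "(\<Sum>i \<in> UNIV. \<Sum>j \<in> UNIV. \<beta> k i * ?x $ (k, i, j) + \<beta> k j * ?x $ (k, i, j))
      = (if k = l then 0 else \<Sum>i \<in> UNIV. \<alpha> k i)" for k
  proof (cases "k = l")
    case False
    then have "slot_number k \<noteq> 1" using l injD[OF inj_slot_number, of k l] by auto
    then have "2 \<le> slot_number k" using slot_number_pos[of k] by linarith
    note one = tournament_sums(2)[OF T this]
    have "(\<Sum>i \<in> UNIV. \<Sum>j \<in> UNIV. \<beta> k i * ?x $ (k, i, j) + \<beta> k j * ?x $ (k, i, j))
        = (\<Sum>i \<in> UNIV. \<Sum>j \<in> UNIV. \<beta> k i * ?x $ (k, i, j))
          + (\<Sum>i \<in> UNIV. \<Sum>j \<in> UNIV. \<beta> k i * ?x $ (k, j, i))"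
      by (subst (3) sum.swap) (simp add: sum.distrib)
    also have "\<dots> = (\<Sum>i \<in> UNIV. \<beta> k i * (\<Sum>j \<in> UNIV. ?x $ (k, i, j) + ?x $ (k, j, i)))"
      by (simp add: sum.distrib sum_distrib_left distrib_left)
    finally show ?thesis using False by (simp add: one \<beta>_def)
  qed (simp add: \<beta>_def)
  have "(\<Sum>k \<in> UNIV. if k = l then 0 else \<Sum>i \<in> UNIV. \<alpha> k i) = (\<Sum>k \<in> UNIV - {l}. \<Sum>i \<in> UNIV. \<alpha> k i)"
    by (subst sum.remove[of _ l]) auto
  then show ?thesis by (simp add: main A B)
qed

section \<open>Opponents in a tour, and tournaments avoiding a trip\<close>

lemma slot_of_flip: "h i j \<Longrightarrow> slot_of f g (flip i j h) i j = g i j"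
  by (simp add: slot_of_def flip_def)

lemma tour_functional: "(k, i, j) \<in> tour f g h \<Longrightarrow> (l, i, j) \<in> tour f g h \<Longrightarrow> k = l"
  by (simp add: tour_def)

text \<open>The slot \<open>k\<close> determines the palette, and with \<open>t\<close> also the
  opponent. A home match of \<open>t\<close> in slot \<open>k\<close> would thus be against
  \<open>u\<close> in the same palette, which the orientation forbids.\<close>

lemma tour_unique_opponent:
  assumes "schedule f g" "orientation h" "(k, u, t) \<in> tour f g h"
  shows "(k, t, x) \<notin> tour f g h" and "(k, x, t) \<in> tour f g h \<Longrightarrow> x = u"
proof -
  note sch = scheduleD[OF assms(1)]
  have ut: "u \<noteq> t" "k = slot_of f g h u t" using assms(3) by (auto simp: tour_def)
  have com: "f t x = f x t" "g t x = g x t"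
    by (rule edge_coloring_commute[OF sch(1)] edge_coloring_commute[OF sch(2)])+
  \<comment> \<open>\<open>B\<close> records which colouring supplies the slot, so home and away
    matches of \<open>t\<close> are covered at once.\<close>
  have B: "x = u \<and> B = h u t" if "x \<noteq> t" "k = (if B then f x t else g x t)" for B
  proof (cases "h u t")
    case True
    then have "B" "f x t = f u t"
      using that ut sch(3)[of u t x t] by (simp_all add: slot_of_def split: if_splits)
    then show ?thesis using True edge_coloring_inj'[OF sch(1), of x t u] that(1) ut(1) by blast
  next
    case False
    then have "\<not> B" "g x t = g u t"
      using that ut sch(3)[of x t u t] by (simp_all add: slot_of_def split: if_splits)
    then show ?thesis using False edge_coloring_inj'[OF sch(2), of x t u] that(1) ut(1) by blast
  qed
  show "x = u" if "(k, x, t) \<in> tour f g h"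
    using B[of "h x t"] that by (simp add: tour_def slot_of_def)
  show "(k, t, x) \<notin> tour f g h"
  proof
    assume "(k, t, x) \<in> tour f g h"
    then have "t \<noteq> x" "k = slot_of f g h t x" by (auto simp: tour_def)
    moreover have "slot_of f g h t x = (if h t x then f x t else g x t)"
      using com by (simp add: slot_of_def)
    ultimately have "x = u \<and> h t x = h u t" using B[of "h t x"] by metis
    then show False using orientationD[OF assms(2) ut(1)] by auto
  qed
qed

context tournament_size
begin

text \<open>Team \<open>t\<close> plays at \<open>u\<close> and right afterwards at
  \<open>v\<close>. As it visits each foreign venue once, it reaches \<open>v\<close> only from
  \<open>u\<close> and leaves \<open>u\<close> only for \<open>v\<close>.\<close>

lemma ex_tournament_not_travelling:
  fixes t i j i\<^sub>0 j\<^sub>0 :: 'v and k\<^sub>0 :: 's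
  assumes "i \<noteq> j" "i\<^sub>0 \<noteq> j\<^sub>0"
  obtains T :: "('s, 'v) match set"
  where "is_tournament T" "(k\<^sub>0, i\<^sub>0, j\<^sub>0) \<notin> T" "\<not> travels T t i j"
proof -
  \<comment> \<open>A trip from home to \<open>j\<close> is blocked by arriving at
    \<open>v = j\<close> from \<open>u\<close>; a trip from a foreign \<open>i\<close> by leaving
    \<open>u = i\<close> for some \<open>v \<noteq> j\<close>.\<close>
  obtain u v where uv: "distinct [t, u, v]" "i = t \<and> v = j \<or> i \<noteq> t \<and> u = i \<and> v \<noteq> j"
  proof (cases "i = t")
    case True
    obtain u where "u \<notin> {t, j}"
      by (rule ex_teams_distinct[of "{t, j}"]) (auto simp: card_insert_if)
    then show ?thesis using that[of u j] True assms(1) by auto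
  next
    case False
    obtain v where "v \<notin> {t, i, j}"
      by (rule ex_teams_distinct[of "{t, i, j}"]) (auto simp: card_insert_if)
    then show ?thesis using that[of i v] False by auto
  qed
  have slot: "\<exists>k :: 's. slot_number k = p" if "1 \<le> p" "p \<le> 4" for p
  proof -
    have "p \<in> range (slot_number :: 's \<Rightarrow> nat)"
      unfolding range_slot_number using that card_teams(1) card_slots by simp
    then show ?thesis by auto
  qed
  \<comment> \<open>Slots 3 and 4, or else 1 and 2, are consecutive and avoid
    \<open>k\<^sub>0\<close>.\<close>
  obtain p :: nat and k\<^sub>1 k\<^sub>2 :: 's where k: "slot_number k\<^sub>1 = p" "slot_number k\<^sub>2 = p + 1"
    "k\<^sub>0 \<noteq> k\<^sub>1" "k\<^sub>0 \<noteq> k\<^sub>2"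
  proof (cases "slot_number k\<^sub>0 \<le> 2")
    case True
    obtain k\<^sub>1 k\<^sub>2 :: 's where "slot_number k\<^sub>1 = 3" "slot_number k\<^sub>2 = 4"
      using slot[of 3] slot[of 4] by auto
    moreover from this have "k\<^sub>0 \<noteq> k\<^sub>1" "k\<^sub>0 \<noteq> k\<^sub>2" using True by auto
    ultimately show ?thesis using that[of k\<^sub>1 3 k\<^sub>2] by simp
  next
    case False
    obtain k\<^sub>1 k\<^sub>2 :: 's where "slot_number k\<^sub>1 = 1" "slot_number k\<^sub>2 = 2"
      using slot[of 1] slot[of 2] by auto
    moreover from this have "k\<^sub>0 \<noteq> k\<^sub>1" "k\<^sub>0 \<noteq> k\<^sub>2" using False by auto
    ultimately show ?thesis using that[of k\<^sub>1 1 k\<^sub>2] by simp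
  qed
  then have "distinct [k\<^sub>1, k\<^sub>2, k\<^sub>0]" by auto
  then obtain f g where fg: "schedule f g" "f u t = k\<^sub>1" "f v t = k\<^sub>2" "\<And>x y. g x y \<noteq> k\<^sub>0"
    using obtain_schedule_path[OF uv(1), of k\<^sub>1 k\<^sub>2 k\<^sub>0] by blast
  \<comment> \<open>If the pair of \<open>i\<^sub>0\<close> and \<open>j\<^sub>0\<close> is still
    free, its match at \<open>i\<^sub>0\<close> is sent to a \<open>g\<close> slot, never
    \<open>k\<^sub>0\<close>. Otherwise its \<open>f\<close> slot is \<open>k\<^sub>1\<close> or
    \<open>k\<^sub>2\<close>.\<close>
  define R where "R = {(u, t), (v, t)} \<union>
    (if {i\<^sub>0, j\<^sub>0} = {u, t} \<or> {i\<^sub>0, j\<^sub>0} = {v, t} then {} else {(j\<^sub>0, i\<^sub>0)})"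
  have "(y, x) \<notin> R" if "(x, y) \<in> R" for x y
    using that uv(1) assms(2) by (auto simp: R_def doubleton_eq_iff split: if_splits)
  then obtain h where h: "orientation h" "\<And>x y. (x, y) \<in> R \<Longrightarrow> h x y"
    by (rule obtain_orientation[OF _ that])
  let ?T = "tour f g h"
  have T1: "(k\<^sub>1, u, t) \<in> ?T" and T2: "(k\<^sub>2, v, t) \<in> ?T"
    using h(2)[of u t] h(2)[of v t] uv(1) fg by (auto simp: tour_def slot_of_def R_def)
  note unique1 = tour_unique_opponent[OF fg(1) h(1) T1]
  note unique2 = tour_unique_opponent[OF fg(1) h(1) T2]
  have "(k\<^sub>0, i\<^sub>0, j\<^sub>0) \<notin> ?T"
  proof
    assume "(k\<^sub>0, i\<^sub>0, j\<^sub>0) \<in> ?T"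
    then have f: "h i\<^sub>0 j\<^sub>0" "f i\<^sub>0 j\<^sub>0 = k\<^sub>0"
      using fg(4)[of i\<^sub>0 j\<^sub>0] by (auto simp: tour_def slot_of_def split: if_splits)
    then have "(j\<^sub>0, i\<^sub>0) \<notin> R" using h(2)[of j\<^sub>0 i\<^sub>0] orientationD[OF h(1) assms(2)] by auto
    then have "{i\<^sub>0, j\<^sub>0} = {u, t} \<or> {i\<^sub>0, j\<^sub>0} = {v, t}" by (auto simp: R_def split: if_splits)
    then have "f i\<^sub>0 j\<^sub>0 = k\<^sub>1 \<or> f i\<^sub>0 j\<^sub>0 = k\<^sub>2"
      using fg(2,3) edge_coloring_commute[OF scheduleD(1)[OF fg(1)], of i\<^sub>0 j\<^sub>0]
      by (auto simp: doubleton_eq_iff)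
    then show False using f(2) k(3,4) by simp
  qed
  moreover have "\<not> travels ?T t i j"
  proof
    assume "travels ?T t i j"
    then obtain q where q: "q \<le> CARD('s)" "at_venue ?T t q i" "at_venue ?T t (q + 1) j"
      by (auto simp: travels_def)
    \<comment> \<open>Positions \<open>p\<close> and \<open>p + 1\<close> are slots, neither the
      start nor the end.\<close>
    have p: "1 \<le> p" "p + 1 \<le> CARD('s)"
      using slot_number_pos[of k\<^sub>1] slot_number_le[of k\<^sub>2] k by auto
    from uv(2) show False
    proof
      assume A: "i = t \<and> v = j"
      then have "j \<noteq> t" using uv(1) by auto
      then obtain k where "slot_number k = q + 1" "(k, v, t) \<in> ?T"
        using q(3) A by (auto simp: at_venue_def split: if_splits)
      then have "q = p" using tour_functional[OF T2] k(2) by fastforce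
      then obtain k where "slot_number k = p" "\<exists>x. (k, t, x) \<in> ?T"
        using q(2) A p by (auto simp: at_venue_def split: if_splits)
      then show False using unique1(1) injD[OF inj_slot_number, of k k\<^sub>1] k(1) by auto
    next
      assume B: "i \<noteq> t \<and> u = i \<and> v \<noteq> j"
      then obtain k where "slot_number k = q" "(k, u, t) \<in> ?T"
        using q(2) by (auto simp: at_venue_def split: if_splits)
      then have "q = p" using tour_functional[OF T1] k(1) by fastforce
      then obtain k where "slot_number k = p + 1" "(\<exists>x. (k, t, x) \<in> ?T) \<or> (k, j, t) \<in> ?T"
        using q(3) p by (auto simp: at_venue_def split: if_splits)
      then show False
        using unique2 injD[OF inj_slot_number, of k k\<^sub>2] k(2) B by auto
    qed
  qed
  moreover have "is_tournament ?T" by (rule is_tournament_tour[OF card_slots fg(1) h(1)])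
  ultimately show ?thesis using that by blast
qed

end

section \<open>Functionals constant on the face and at one further tournament\<close>

text \<open>The tour of \<open>f\<^sub>0\<close>, \<open>g\<^sub>0\<close>, \<open>h\<^sub>0\<close>
  contains the match and so lies off the face.\<close>

locale face_functional = tournament_size slots teams
  for slots :: "'s::{finite,linorder} itself" and teams :: "'v::finite itself" +
  fixes w :: "real ^ ('s \<times> 'v \<times> 'v)" and \<beta> :: real
    and k\<^sub>0 :: 's and i\<^sub>0 j\<^sub>0 :: 'v and f\<^sub>0 g\<^sub>0 h\<^sub>0
  assumes ij\<^sub>0: "i\<^sub>0 \<noteq> j\<^sub>0"
    and face: "\<And>T. is_tournament T \<Longrightarrow> (k\<^sub>0, i\<^sub>0, j\<^sub>0) \<notin> T \<Longrightarrow> w \<bullet> incidence_vector T = \<beta>"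
    and schedule\<^sub>0: "schedule f\<^sub>0 g\<^sub>0" and orientation\<^sub>0: "orientation h\<^sub>0"
    and match\<^sub>0: "f\<^sub>0 i\<^sub>0 j\<^sub>0 = k\<^sub>0" "h\<^sub>0 i\<^sub>0 j\<^sub>0"
    and off_face: "w \<bullet> incidence_vector (tour f\<^sub>0 g\<^sub>0 h\<^sub>0) = \<beta>"
begin

lemma face_tour:
  assumes "schedule f g" "orientation h" "slot_of f g h i\<^sub>0 j\<^sub>0 \<noteq> k\<^sub>0"
  shows "w \<bullet> incidence_vector (tour f g h) = \<beta>"
  by (rule face[OF is_tournament_tour[OF card_slots assms(1,2)]])
    (use assms(3) in \<open>simp add: tour_def\<close>)

lemma flip_face:
  assumes "schedule f g" "orientation h" "h i j" "i \<noteq> j"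
    and "slot_of f g h i\<^sub>0 j\<^sub>0 \<noteq> k\<^sub>0" "slot_of f g (flip i j h) i\<^sub>0 j\<^sub>0 \<noteq> k\<^sub>0"
  shows "w $ (f i j, i, j) - w $ (f i j, j, i) = w $ (g i j, i, j) - w $ (g i j, j, i)"
  using inner_tour_flip[OF assms(1-4), of w] face_tour[OF assms(1,2,5)]
    face_tour[OF assms(1) orientation_flip[OF assms(2)] assms(6)]
  by simp

text \<open>The case left out is the one in which one of the two tours compared would contain the
  forbidden match.\<close>

lemma flip_face_slots:
  assumes "i \<noteq> j" "k \<noteq> l" "{i, j} = {i\<^sub>0, j\<^sub>0} \<Longrightarrow> k\<^sub>0 \<notin> {k, l}"
  shows "w $ (k, i, j) - w $ (k, j, i) = w $ (l, i, j) - w $ (l, j, i)"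
proof -
  obtain f g where fg: "schedule f g" "f i j = k" "g i j = l"
    by (rule obtain_schedule_edge[OF assms(1,2)])
  \<comment> \<open>For a different pair, \<open>i\<^sub>0\<close> and \<open>j\<^sub>0\<close> are
    directed so that their match at \<open>i\<^sub>0\<close> is outside slot
    \<open>k\<^sub>0\<close>; flipping \<open>i\<close> and \<open>j\<close> does not affect
    it.\<close>
  define R where "R = (if {i, j} = {i\<^sub>0, j\<^sub>0} then {(i, j)}
    else {(i, j), if f i\<^sub>0 j\<^sub>0 = k\<^sub>0 then (j\<^sub>0, i\<^sub>0) else (i\<^sub>0, j\<^sub>0)})"
  have "(y, x) \<notin> R" if "(x, y) \<in> R" for x y
    using that assms(1) ij\<^sub>0 by (auto simp: R_def doubleton_eq_iff split: if_splits)
  then obtain h where h: "orientation h" "\<And>x y. (x, y) \<in> R \<Longrightarrow> h x y"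
    by (rule obtain_orientation[OF _ that])
  have hij: "h i j" using h(2)[of i j] by (simp add: R_def)
  have "slot_of f g h i\<^sub>0 j\<^sub>0 \<noteq> k\<^sub>0 \<and> slot_of f g (flip i j h) i\<^sub>0 j\<^sub>0 \<noteq> k\<^sub>0"
  proof (cases "{i, j} = {i\<^sub>0, j\<^sub>0}")
    case True
    then have "i = i\<^sub>0 \<and> j = j\<^sub>0 \<or> i = j\<^sub>0 \<and> j = i\<^sub>0" by (simp add: doubleton_eq_iff)
    then have "f i\<^sub>0 j\<^sub>0 = k \<and> g i\<^sub>0 j\<^sub>0 = l"
      using fg edge_coloring_commute[OF scheduleD(1)[OF fg(1)]]
        edge_coloring_commute[OF scheduleD(2)[OF fg(1)]] by metis
    then show ?thesis using assms(3)[OF True] by (auto simp: slot_of_def)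
  next
    case False
    then have flip: "flip i j h i\<^sub>0 j\<^sub>0 = h i\<^sub>0 j\<^sub>0" by (auto simp: flip_def)
    have "f i\<^sub>0 j\<^sub>0 \<noteq> g i\<^sub>0 j\<^sub>0" using scheduleD(3)[OF fg(1)] ij\<^sub>0 by blast
    moreover have "h i\<^sub>0 j\<^sub>0 \<longleftrightarrow> f i\<^sub>0 j\<^sub>0 \<noteq> k\<^sub>0"
    proof (cases "f i\<^sub>0 j\<^sub>0 = k\<^sub>0")
      case True
      then have "h j\<^sub>0 i\<^sub>0" using h(2)[of j\<^sub>0 i\<^sub>0] False by (simp add: R_def)
      then show ?thesis using True orientationD[OF h(1) ij\<^sub>0] by simp
    next
      case ne: False
      then show ?thesis using h(2)[of i\<^sub>0 j\<^sub>0] False by (simp add: R_def)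
    qed
    ultimately have "slot_of f g h i\<^sub>0 j\<^sub>0 \<noteq> k\<^sub>0" by (auto simp: slot_of_def)
    then show ?thesis using flip by (simp add: slot_of_def)
  qed
  then show ?thesis using flip_face[OF fg(1) h(1) hij assms(1)] fg by simp
qed

text \<open>The missing case comes from the tournament off the face: flipping it at
  \<open>i\<^sub>0\<close>, \<open>j\<^sub>0\<close> leads onto the face and links
  \<open>k\<^sub>0\<close> with the slot \<open>g\<^sub>0 i\<^sub>0 j\<^sub>0\<close>.\<close>

lemma home_away:
  assumes "i \<noteq> j"
  shows "w $ (k, i, j) - w $ (k, j, i) = w $ (l, i, j) - w $ (l, j, i)"
proof -
  let ?l = "g\<^sub>0 i\<^sub>0 j\<^sub>0"
  have l: "?l \<noteq> k\<^sub>0" using scheduleD(3)[OF schedule\<^sub>0, of i\<^sub>0 j\<^sub>0 i\<^sub>0 j\<^sub>0] ij\<^sub>0 match\<^sub>0(1) by auto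
  have "w \<bullet> incidence_vector (tour f\<^sub>0 g\<^sub>0 (flip i\<^sub>0 j\<^sub>0 h\<^sub>0)) = \<beta>"
    by (rule face_tour[OF schedule\<^sub>0 orientation_flip[OF orientation\<^sub>0]])
      (use l slot_of_flip[of h\<^sub>0 i\<^sub>0 j\<^sub>0 f\<^sub>0 g\<^sub>0] match\<^sub>0(2) in simp)
  then have 0: "w $ (k\<^sub>0, i\<^sub>0, j\<^sub>0) - w $ (k\<^sub>0, j\<^sub>0, i\<^sub>0) = w $ (?l, i\<^sub>0, j\<^sub>0) - w $ (?l, j\<^sub>0, i\<^sub>0)"
    using inner_tour_flip[OF schedule\<^sub>0 orientation\<^sub>0 match\<^sub>0(2) ij\<^sub>0, of w] off_face match\<^sub>0(1)
    by simp
  have 1: "w $ (k, i\<^sub>0, j\<^sub>0) - w $ (k, j\<^sub>0, i\<^sub>0) = w $ (?l, i\<^sub>0, j\<^sub>0) - w $ (?l, j\<^sub>0, i\<^sub>0)" for k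
  proof (cases "k = k\<^sub>0 \<or> k = ?l")
    case False
    then show ?thesis using flip_face_slots[OF ij\<^sub>0, of k ?l] l by auto
  qed (use 0 in auto)
  show ?thesis
  proof (cases "{i, j} = {i\<^sub>0, j\<^sub>0}")
    case True
    then have "i = i\<^sub>0 \<and> j = j\<^sub>0 \<or> i = j\<^sub>0 \<and> j = i\<^sub>0" by (simp add: doubleton_eq_iff)
    then show ?thesis using 1[of k] 1[of l] by auto
  next
    case False
    then show ?thesis using flip_face_slots[OF assms, of k l] by (cases "k = l") auto
  qed
qed

text \<open>A tour containing the forbidden match is flipped onto the face; by
  \<open>home_away\<close> the flip preserves the value.\<close>

lemma inner_tour_const:
  assumes "schedule f g" "orientation h"
  shows "w \<bullet> incidence_vector (tour f g h) = \<beta>"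
proof (cases "slot_of f g h i\<^sub>0 j\<^sub>0 = k\<^sub>0")
  case True
  have ne: "f i\<^sub>0 j\<^sub>0 \<noteq> g i\<^sub>0 j\<^sub>0" using scheduleD(3)[OF assms(1)] ij\<^sub>0 by blast
  obtain i j where ij: "{i, j} = {i\<^sub>0, j\<^sub>0}" "h i j" "i \<noteq> j"
  proof (cases "h i\<^sub>0 j\<^sub>0")
    case False
    then show ?thesis using that[of j\<^sub>0 i\<^sub>0] orientationD[OF assms(2) ij\<^sub>0] ij\<^sub>0 by auto
  qed (use that[of i\<^sub>0 j\<^sub>0] ij\<^sub>0 in auto)
  have "w \<bullet> incidence_vector (tour f g (flip i j h)) = \<beta>"
    by (rule face_tour[OF assms(1) orientation_flip[OF assms(2)]])
      (use True ne ij(1) in \<open>auto simp: slot_of_def flip_def split: if_splits\<close>)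
  then show ?thesis
    using inner_tour_flip[OF assms ij(2,3), of w] home_away[OF ij(3), of "f i j" "g i j"] by simp
qed (rule face_tour[OF assms])

text \<open>Renaming \<open>k\<close> and \<open>l\<close> into each other preserves the value of
  every tour. Adding this relation for an orientation and its reverse counts both arcs of each edge
  and eliminates the orientation.\<close>

lemma slot_swap:
  assumes "schedule f g" "k \<noteq> l"
    and fl: "\<And>i j. i \<noteq> j \<Longrightarrow> f i j \<noteq> l" and gk: "\<And>i j. i \<noteq> j \<Longrightarrow> g i j \<noteq> k"
  shows "(\<Sum>(i, j) \<in> arcs. of_bool (f i j = k) * (w $ (k, i, j) - w $ (l, i, j)))
       = (\<Sum>(i, j) \<in> arcs. of_bool (g i j = l) * (w $ (k, i, j) - w $ (l, i, j)))"
proof -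
  let ?\<tau> = "Transposition.transpose k l"
  let ?D = "\<lambda>i j. w $ (k, i, j) - w $ (l, i, j)"
  have swap: "(\<Sum>(i, j) \<in> arcs. (of_bool (slot_of f g h i j = k) - of_bool (slot_of f g h i j = l)) * ?D i j) = 0"
    if h: "orientation h" for h
  proof -
    have "schedule (\<lambda>i j. ?\<tau> (f i j)) (\<lambda>i j. ?\<tau> (g i j))"
      by (rule schedule_comp[OF assms(1)]) simp
    then have "w \<bullet> incidence_vector (tour f g h)
        - w \<bullet> incidence_vector (tour (\<lambda>i j. ?\<tau> (f i j)) (\<lambda>i j. ?\<tau> (g i j)) h) = 0"
      using inner_tour_const[OF _ h] assms(1) by simp
    moreover have "slot_of (\<lambda>i j. ?\<tau> (f i j)) (\<lambda>i j. ?\<tau> (g i j)) h i j = ?\<tau> (slot_of f g h i j)" for i j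
      by (simp add: slot_of_def)
    ultimately have "(\<Sum>(i, j) \<in> arcs. w $ (slot_of f g h i j, i, j) - w $ (?\<tau> (slot_of f g h i j), i, j)) = 0"
      by (simp add: inner_tour sum_subtractf case_prod_unfold)
    moreover have "w $ (s, i, j) - w $ (?\<tau> s, i, j) = (of_bool (s = k) - of_bool (s = l)) * ?D i j" for s i j
      using assms(2) by (auto simp: Transposition.transpose_def)
    ultimately show ?thesis by simp
  qed
  obtain h :: "'v \<Rightarrow> 'v \<Rightarrow> bool" where h: "orientation h"
    using orientation\<^sub>0 by blast
  have "(\<Sum>(i, j) \<in> arcs. of_bool (f i j = k) * ?D i j) - (\<Sum>(i, j) \<in> arcs. of_bool (g i j = l) * ?D i j)
      = (\<Sum>(i, j) \<in> arcs. (of_bool (slot_of f g h i j = k) - of_bool (slot_of f g h i j = l)) * ?D i j)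
        + (\<Sum>(i, j) \<in> arcs. (of_bool (slot_of f g (\<lambda>i j. \<not> h i j) i j = k)
            - of_bool (slot_of f g (\<lambda>i j. \<not> h i j) i j = l)) * ?D i j)"
    unfolding sum_subtractf[symmetric] sum.distrib[symmetric]
    by (rule sum.cong) (auto simp: slot_of_def arcs_def fl gk)
  then show ?thesis using swap[OF h] swap[OF orientation_Not[OF h]] by simp
qed

text \<open>The matchings of slots \<open>k\<close> and \<open>l\<close> agree outside the 4-cycle,
  so in \<open>slot_swap\<close> only its edges survive.\<close>

lemma alternating_cycle:
  assumes "distinct [a, b, c, d]" "k \<noteq> l"
    and D: "\<And>i j. D i j = w $ (k, i, j) - w $ (l, i, j)"
  shows "D a b + D c d = D b c + D d a"
proof -
  let ?\<pi> = "Transposition.transpose a c"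
  obtain f g where fg: "schedule f g" "f a b = k" "f c d = k"
    and gl: "\<And>x y. g x y = l \<longleftrightarrow> f (?\<pi> x) (?\<pi> y) = k"
    by (rule obtain_schedule_alternating[OF assms(1,2) that])
  note sch = scheduleD[OF fg(1)]
  have inj: "?\<pi> x = ?\<pi> y \<longleftrightarrow> x = y" for x y by (metis transpose_involutory)
  have ab: "a \<noteq> b" using assms(1) by simp
  have gk: "g i j \<noteq> k" if "i \<noteq> j" for i j
    using sch(3)[OF ab that] fg(2) by simp
  have "g (?\<pi> a) (?\<pi> b) = l" using gl fg(2) by simp
  moreover have "?\<pi> a \<noteq> ?\<pi> b" using ab inj by blast
  ultimately have fl: "f i j \<noteq> l" if "i \<noteq> j" for i j
    using sch(3)[OF that, of "?\<pi> a" "?\<pi> b"] by metis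
  have "(\<Sum>(i, j) \<in> arcs. of_bool (f i j = k) * D i j)
      = (\<Sum>(i, j) \<in> arcs. of_bool (f (?\<pi> i) (?\<pi> j) = k) * D i j)"
    using slot_swap[OF fg(1) assms(2) fl gk] by (simp add: D gl)
  \<comment> \<open>Reindexing moves the transposition to the argument of \<open>D\<close>; both
    sums now run over the same matching.\<close>
  also have "\<dots> = (\<Sum>(i, j) \<in> arcs. of_bool (f i j = k) * D (?\<pi> i) (?\<pi> j))"
    by (rule sum.reindex_bij_witness[of _ "map_prod ?\<pi> ?\<pi>" "map_prod ?\<pi> ?\<pi>"])
      (auto simp: arcs_def inj)
  finally have "(\<Sum>(i, j) \<in> arcs. of_bool (f i j = k) * (D i j - D (?\<pi> i) (?\<pi> j))) = 0"
    by (simp add: sum_subtractf case_prod_unfold right_diff_distrib)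
  also have "(\<Sum>(i, j) \<in> arcs. of_bool (f i j = k) * (D i j - D (?\<pi> i) (?\<pi> j)))
     = (\<Sum>(i, j) \<in> {(a, b), (b, a), (c, d), (d, c)}. of_bool (f i j = k) * (D i j - D (?\<pi> i) (?\<pi> j)))"
  proof (rule sum.mono_neutral_right)
    show "{(a, b), (b, a), (c, d), (d, c)} \<subseteq> arcs" using assms(1) by (auto simp: arcs_def)
    show "\<forall>x \<in> arcs - {(a, b), (b, a), (c, d), (d, c)}.
        (case x of (i, j) \<Rightarrow> of_bool (f i j = k) * (D i j - D (?\<pi> i) (?\<pi> j))) = 0"
    proof
      fix x assume x: "x \<in> arcs - {(a, b), (b, a), (c, d), (d, c)}"
      obtain i j where [simp]: "x = (i, j)" by (cases x)
      have "i \<noteq> j" using x by (simp add: arcs_def)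
      \<comment> \<open>The only edges of colour \<open>k\<close> at \<open>a\<close> and
        \<open>c\<close> are ab and cd; all others are fixed by the transposition.\<close>
      have "?\<pi> i = i \<and> ?\<pi> j = j" if "f i j = k"
      proof -
        have "i \<noteq> a" using edge_coloring_inj[OF sch(1), of a j b] fg(2) that x ab \<open>i \<noteq> j\<close> by auto
        moreover have "i \<noteq> c"
          using edge_coloring_inj[OF sch(1), of c j d] fg(3) that x assms(1) \<open>i \<noteq> j\<close> by auto
        moreover have "j \<noteq> a"
          using edge_coloring_inj[OF sch(1), of a i b] edge_coloring_commute[OF sch(1), of i a]
            fg(2) that x ab \<open>i \<noteq> j\<close> by auto
        moreover have "j \<noteq> c"
          using edge_coloring_inj[OF sch(1), of c i d] edge_coloring_commute[OF sch(1), of i c]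
            fg(3) that x assms(1) \<open>i \<noteq> j\<close> by auto
        ultimately show ?thesis by simp
      qed
      then show "(case x of (i, j) \<Rightarrow> of_bool (f i j = k) * (D i j - D (?\<pi> i) (?\<pi> j))) = 0"
        by auto
    qed
  qed simp
  also have "\<dots> = D a b - D c b + (D b a - D b c) + (D c d - D a d) + (D d c - D d a)"
  proof -
    have "f b a = k" "f d c = k"
      using fg(2,3) edge_coloring_commute[OF sch(1)] by metis+
    moreover have "?\<pi> b = b" "?\<pi> d = d"
      using assms(1) by (auto simp: Transposition.transpose_def)
    ultimately show ?thesis using assms(1) fg(2,3) by simp
  qed
  \<comment> \<open>By \<open>home_away\<close> the function \<open>D\<close> is symmetric here, so
    the eight terms are twice the desired relation.\<close>
  finally show ?thesis
    using home_away[of a b k l] home_away[of c d k l] home_away[of b c k l] home_away[of a d k l] assms(1)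
    unfolding D by simp
qed

text \<open>Once \<open>w\<close> is slot 1 plus potentials, its value is the same for all
  tournaments, hence equal to that at the tour of \<open>f\<^sub>0\<close>,
  \<open>g\<^sub>0\<close>, \<open>h\<^sub>0\<close>.\<close>

lemma inner_tournament_const:
  assumes "is_tournament T"
  shows "w \<bullet> incidence_vector T = \<beta>"
proof -
  obtain l :: 's where l: "slot_number l = 1"
  proof -
    have "1 \<in> range (slot_number :: 's \<Rightarrow> nat)"
      unfolding range_slot_number using card_slots card_teams(1) by simp
    then show ?thesis using that by (metis imageE)
  qed
  obtain p q r :: 'v where pqr: "distinct [p, q, r]"
  proof -
    obtain r where "r \<notin> {i\<^sub>0, j\<^sub>0}"
      by (rule ex_teams_distinct[of "{i\<^sub>0, j\<^sub>0}"]) (auto simp: card_insert_if)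
    then show ?thesis using that[of i\<^sub>0 j\<^sub>0 r] ij\<^sub>0 by auto
  qed
  have "\<exists>\<alpha>. k \<noteq> l \<longrightarrow> (\<forall>i j. i \<noteq> j \<longrightarrow> w $ (k, i, j) = w $ (l, i, j) + \<alpha> i + \<alpha> j)" for k
  proof (cases "k = l")
    case False
    define D where "D i j = w $ (k, i, j) - w $ (l, i, j)" for i j
    have sym: "D i j = D j i" for i j
      using home_away[of i j k l] by (cases "i = j") (auto simp: D_def)
    have cycle: "D a b + D c d = D b c + D d a" if "distinct [a, b, c, d]" for a b c d
      by (rule alternating_cycle[OF that False D_def])
    obtain \<alpha> where \<alpha>: "\<And>i j. i \<noteq> j \<Longrightarrow> D i j = \<alpha> i + \<alpha> j"
      by (rule additive_if_alternating_cycles[of D, OF sym pqr cycle that])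
    have "w $ (k, i, j) = w $ (l, i, j) + \<alpha> i + \<alpha> j" if "i \<noteq> j" for i j
      using \<alpha>[OF that] unfolding D_def by linarith
    then show ?thesis by blast
  qed simp
  then have "\<forall>k. \<exists>\<alpha>. k \<noteq> l \<longrightarrow> (\<forall>i j. i \<noteq> j \<longrightarrow> w $ (k, i, j) = w $ (l, i, j) + \<alpha> i + \<alpha> j)"
    by blast
  from choice[OF this] obtain \<alpha> where
    \<alpha>: "\<And>k i j. k \<noteq> l \<Longrightarrow> i \<noteq> j \<Longrightarrow> w $ (k, i, j) = w $ (l, i, j) + \<alpha> k i + \<alpha> k j"
    by blast
  have T\<^sub>0: "is_tournament (tour f\<^sub>0 g\<^sub>0 h\<^sub>0)"
    by (rule is_tournament_tour[OF card_slots schedule\<^sub>0 orientation\<^sub>0])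
  show ?thesis
    using trans[OF inner_tournament_potential[OF assms l \<alpha>]
        inner_tournament_potential[OF T\<^sub>0 l \<alpha>, symmetric]] off_face
    by (rule trans)
qed

end

section \<open>Points generating the polytope, and the facet\<close>

definition utt_vertices ::
    "((real ^ ('s::{finite,linorder} \<times> 'v::finite \<times> 'v)) \<times> (real ^ ('v \<times> 'v \<times> 'v))) set" where
  "utt_vertices = {(incidence_vector T, y) | T y.
        is_tournament T \<and>
        (\<forall>t i j. if (i, j) \<in> arcs then y $ (t, i, j) \<in> {0, 1} else y $ (t, i, j) = 0) \<and>
        (\<forall>t. \<forall>(i, j) \<in> arcs. y $ (t, i, j) \<ge> travel_vector T $ (t, i, j))}"

lemma utt_polytope_eq_hull: "utt_polytope = convex hull utt_vertices"
  by (simp only: utt_polytope_def utt_vertices_def)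

lemma incidence_vector_bounds:
  "0 \<le> incidence_vector B $ a" "incidence_vector B $ a \<le> 1"
  by (simp_all add: incidence_vector_def)

lemma travel_vector_bounds: "0 \<le> travel_vector T $ a" "travel_vector T $ a \<le> 1"
  unfolding travel_vector_def by (rule incidence_vector_bounds)+

text \<open>The largest admissible travel part, compatible with every tournament.\<close>

definition all_travels :: "real ^ ('v::finite \<times> 'v \<times> 'v)" where
  "all_travels = incidence_vector (UNIV \<times> arcs)"

lemma all_travels_nth: "all_travels $ (t, i, j) = of_bool ((i, j) \<in> arcs)"
  by (simp add: all_travels_def incidence_vector_def)

lemma all_travels_vertex:
  "is_tournament T \<Longrightarrow> (incidence_vector T, all_travels) \<in> utt_vertices"
  by (auto simp: utt_vertices_def all_travels_nth travel_vector_bounds)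

text \<open>Compared with \<open>all_travels_vertex\<close>, this isolates a single travel
  coordinate.\<close>

lemma all_travels_minus_vertex:
  assumes "is_tournament T" "\<not> travels T t i j" "(i, j) \<in> arcs"
  shows "(incidence_vector T, all_travels - axis (t, i, j) 1) \<in> utt_vertices"
proof -
  let ?y = "all_travels - axis (t, i, j) 1 :: real ^ ('b \<times> 'b \<times> 'b)"
  have y: "?y $ (t', i', j') = of_bool ((i', j') \<in> arcs \<and> (t', i', j') \<noteq> (t, i, j))" for t' i' j'
    using assms(3) by (auto simp: all_travels_nth axis_def)
  have "travel_vector T $ (t, i, j) = 0"
    using assms(2) by (simp add: travel_vector_def incidence_vector_def)
  then have "travel_vector T $ (t', i', j') \<le> ?y $ (t', i', j')" if "(i', j') \<in> arcs" for t' i' j'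
    using that by (auto simp: y travel_vector_bounds simp del: vector_minus_component)
  then show ?thesis
    using assms(1) unfolding utt_vertices_def
    by (auto simp: y simp del: vector_minus_component)
qed

lemma utt_polytope_nonneg: "z \<in> utt_polytope \<Longrightarrow> 0 \<le> match_coeff m \<bullet> z"
proof -
  assume z: "z \<in> utt_polytope"
  have "utt_vertices \<subseteq> {z. 0 \<le> match_coeff m \<bullet> z}"
    by (auto simp: utt_vertices_def match_coeff_inner incidence_vector_bounds)
  then have "utt_polytope \<subseteq> {z. 0 \<le> match_coeff m \<bullet> z}"
    unfolding utt_polytope_eq_hull
    using convex_halfspace_ge[of 0 "match_coeff m"] by (intro hull_minimal) auto
  then show ?thesis using z by auto
qed

text \<open>The face is proper because of \<open>q\<close>, and adding one point raises the affine
  dimension by at most one.\<close>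

lemma facet_of_if_affine_hull_insert:
  fixes P :: "'a::euclidean_space set"
  assumes "convex P" "\<And>z. z \<in> P \<Longrightarrow> b \<le> a \<bullet> z"
    and "{z \<in> P. a \<bullet> z = b} \<noteq> {}" "q \<in> P" "a \<bullet> q \<noteq> b"
    and hull: "P \<subseteq> affine hull (insert q {z \<in> P. a \<bullet> z = b})"
  shows "{z \<in> P. a \<bullet> z = b} facet_of P"
proof -
  let ?F = "{z \<in> P. a \<bullet> z = b}"
  have F: "?F = P \<inter> {z. a \<bullet> z = b}" by auto
  have face: "?F face_of P"
    unfolding F by (rule face_of_Int_supporting_hyperplane_ge) (use assms(1,2) in auto)
  have "?F \<noteq> P" using assms(4,5) by blast
  then have "aff_dim ?F < aff_dim P" by (rule face_of_aff_dim_lt[OF assms(1) face])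
  moreover have "aff_dim P \<le> aff_dim ?F + 1"
  proof -
    have "aff_dim P \<le> aff_dim (affine hull (insert q ?F))" by (rule aff_dim_subset[OF hull])
    also have "\<dots> = aff_dim (insert q ?F)" by (rule aff_dim_affine_hull)
    also have "\<dots> \<le> aff_dim ?F + 1" by (simp add: aff_dim_insert)
    finally show ?thesis .
  qed
  ultimately show ?thesis using face assms(3) by (simp add: facet_of_def)
qed

theorem theorem8:
  fixes n :: nat
    and k :: "'s::{finite,linorder}"
    and i j :: "'v::finite"
  assumes "4 \<le> n" and "even n"
    and "CARD('v) = n" and "CARD('s) = 2 * n - 2"
    and "(k, i, j) \<in> matches"
  shows "facet_defining_ge (match_coeff (k, i, j)) 0
           (utt_polytope :: ((real ^ ('s \<times> 'v \<times> 'v)) \<times> (real ^ ('v \<times> 'v \<times> 'v))) set)"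
proof -
  interpret tournament_size "TYPE('s)" "TYPE('v)"
    by standard (use assms in auto)
  let ?P = "utt_polytope :: ((real ^ ('s \<times> 'v \<times> 'v)) \<times> (real ^ ('v \<times> 'v \<times> 'v))) set"
  let ?F = "{z \<in> ?P. match_coeff (k, i, j) \<bullet> z = 0}"
  have ij: "i \<noteq> j" using assms(5) by (simp add: matches_def arcs_def)
  have F: "(incidence_vector T, y) \<in> ?F"
    if "(incidence_vector T, y) \<in> utt_vertices" "(k, i, j) \<notin> T" for T y
    using that hull_inc[of _ utt_vertices convex]
    by (simp add: utt_polytope_eq_hull match_coeff_inner) (simp add: incidence_vector_def)
  obtain T\<^sub>1 :: "('s, 'v) match set" where T\<^sub>1: "is_tournament T\<^sub>1" "(k, i, j) \<notin> T\<^sub>1"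
    by (rule ex_tournament_not_travelling[OF ij ij])
  \<comment> \<open>A second slot is needed for the return match of \<open>i\<close> and
    \<open>j\<close>.\<close>
  have "card {k} < CARD('s)" using assms by simp
  then have "{k} \<noteq> UNIV" by (metis less_irrefl)
  then obtain l where "l \<notin> {k}" by (metis UNIV_eq_I)
  then have "k \<noteq> l" by auto
  then obtain f g where fg: "schedule f g" "f i j = k"
    by (rule obtain_schedule_edge[OF ij])
  obtain h where h: "orientation h" "h i j"
    by (rule obtain_orientation[of "{(i, j)}"]) (use ij in auto)
  let ?T = "tour f g h"
  let ?q = "(incidence_vector ?T, all_travels) :: (real ^ ('s \<times> 'v \<times> 'v)) \<times> (real ^ ('v \<times> 'v \<times> 'v))"
  have q: "?q \<in> utt_vertices"
    by (rule all_travels_vertex[OF is_tournament_tour[OF card_slots fg(1) h(1)]])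
  have qk: "match_coeff (k, i, j) \<bullet> ?q \<noteq> 0"
    using ij fg(2) h(2) by (simp add: match_coeff_inner incidence_vector_def tour_def slot_of_def)
  have "utt_vertices \<subseteq> affine hull (insert ?q ?F)"
  proof
    fix z :: "(real ^ ('s \<times> 'v \<times> 'v)) \<times> (real ^ ('v \<times> 'v \<times> 'v))"
    assume "z \<in> utt_vertices"
    then obtain T y where z: "z = (incidence_vector T, y)" and T: "is_tournament T"
      and y: "\<And>t i j. (i, j) \<notin> arcs \<Longrightarrow> y $ (t, i, j) = 0"
      unfolding utt_vertices_def by (auto split: if_splits)
    show "z \<in> affine hull (insert ?q ?F)"
    proof (rule mem_affine_hull_if_functionals)
      fix a :: "(real ^ ('s \<times> 'v \<times> 'v)) \<times> (real ^ ('v \<times> 'v \<times> 'v))" and b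
      assume ab: "\<And>x. x \<in> insert ?q ?F \<Longrightarrow> a \<bullet> x = b"
      obtain w d where a: "a = (w, d)" by (cases a)
      \<comment> \<open>Two points of the face differ by just the unit vector of this
        coordinate.\<close>
      have d: "d $ (t, i', j') = 0" if arc: "(i', j') \<in> arcs" for t i' j'
      proof -
        have "i' \<noteq> j'" using arc by (simp add: arcs_def)
        then obtain T' :: "('s, 'v) match set"
          where T': "is_tournament T'" "(k, i, j) \<notin> T'" "\<not> travels T' t i' j'"
          using ex_tournament_not_travelling[OF _ ij] by blast
        have "a \<bullet> (incidence_vector T', all_travels) = b"
          by (rule ab) (use F[OF all_travels_vertex[OF T'(1)] T'(2)] in blast)
        moreover have "a \<bullet> (incidence_vector T', all_travels - axis (t, i', j') 1) = b"
          by (rule ab) (use F[OF all_travels_minus_vertex[OF T'(1,3) arc] T'(2)] in blast)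
        ultimately have "d \<bullet> axis (t, i', j') 1 = 0"
          by (simp add: a inner_diff_right)
        then show ?thesis by (simp add: inner_axis)
      qed
      \<comment> \<open>Nothing is known about \<open>d\<close> outside \<open>arcs\<close>, but
        \<open>y'\<close> vanishes there.\<close>
      have d_inner: "d \<bullet> y' = 0"
        if "\<And>t i j. (i, j) \<notin> arcs \<Longrightarrow> y' $ (t, i, j) = 0" for y'
      proof -
        have "d $ m * y' $ m = 0" for m
          using d that by (cases m) (metis mult_eq_0_iff)
        then show ?thesis unfolding inner_vec_def by (intro sum.neutral) simp
      qed
      have all: "d \<bullet> all_travels = 0" by (rule d_inner) (simp add: all_travels_nth)
      \<comment> \<open>As the travel part contributes nothing, \<open>w\<close> alone takes the
        value \<open>b\<close> on the face and at \<open>?q\<close>.\<close>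
      interpret face_functional "TYPE('s)" "TYPE('v)" w b k i j f g h
      proof
        show "w \<bullet> incidence_vector T = b" if "is_tournament T" "(k, i, j) \<notin> T" for T
          using ab[of "(incidence_vector T, all_travels)"] F[OF all_travels_vertex[OF that(1)] that(2)]
          by (simp add: a all)
        show "w \<bullet> incidence_vector (tour f g h) = b"
          using ab[of ?q] by (simp add: a all)
      qed (use ij fg h in auto)
      show "a \<bullet> z = b"
        using inner_tournament_const[OF T] d_inner[OF y] by (simp add: a z)
    qed simp
  qed
  then have "?P \<subseteq> affine hull (insert ?q ?F)"
    unfolding utt_polytope_eq_hull
    by (rule hull_minimal) (simp add: affine_imp_convex)
  moreover have "?F \<noteq> {}" using F[OF all_travels_vertex[OF T\<^sub>1(1)] T\<^sub>1(2)] by blast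
  moreover have "?q \<in> ?P" unfolding utt_polytope_eq_hull by (rule hull_inc[OF q])
  moreover have "convex ?P" unfolding utt_polytope_eq_hull by (rule convex_convex_hull)
  ultimately have "?F facet_of ?P"
    using facet_of_if_affine_hull_insert[of ?P 0 "match_coeff (k, i, j)" ?q] utt_polytope_nonneg qk
    by blast
  then show ?thesis
    unfolding facet_defining_ge_def using utt_polytope_nonneg by blast
qed

end
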